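(* Let $T_{\min}>0$, let $H$ be a Hilbert space, let $A$ generate a $C_0$-semigroup $(S(t))_{t\ge0}$ on $H$, let $J\in L(H)$, and let the growth condition (defined in the context) hold for $\mathcal S_{\min}(T_{\min})$. If there exist a self-adjoint, strongly differentiable $\bar P:[0,T_{\min}]\to L(H)$ with $0\prec\bar P(\tau)\preceq c_PI$ for some $c_P>0$, and self-adjoint operators $Q:[0,T_{\min}]\to L(H)$, $Q_\infty,R\in L(H)$ satisfying $Q(\tau)\succeq\alpha_qI$, $Q_\infty\succeq\alpha_q^\infty I$, $R\succeq\alpha_rI$ for some $\alpha_q,\alpha_q^\infty,\alpha_r>0$, such that $$\langle d,(\dot{\bar P}(\tau)+A^*\bar P(\tau)+\bar P(\tau)A+Q(\tau))d\rangle_H=0,\quad d\in D(A),\ \tau\in(0,T_{\min}),$$ $$\langle d,(A^*\bar P(T_{\min})+\bar P(T_{\min})A+Q_\infty)d\rangle_H\le0,\quad d\in D(A),$$ $$J^*\bar P(0)J-\bar P(T_{\min})+R=0,$$ then the impulsive system is strongly UGES over $\mathcal S_{\min}(T_{\min})$.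
   Context: Setting. $A:D(A)\subset H\to H$ is the semigroup generator; $J\neq0$ and $JD(A)\subset D(A)$ (standing assumptions). $\mathcal S_{0,\infty}$ is the set of sequences $\sigma=\{t_k\}_{k\ge1}$ with, setting $t_0:=0$, $t_{k+1}>t_k$ for all $k\ge0$ and $t_k\to\infty$; $\mathbb T_\sigma:=\{t_k:k\ge1\}$. $\mathcal S_{\min}(T_{\min}):=\{\sigma\in\mathcal S_{0,\infty}:t_{k+1}-t_k\ge T_{\min}\ \forall k\ge0\}$. The impulsive system is $\dot x(t)=Ax(t)$ for $t\notin\mathbb T_\sigma$, $x(t)=Jx(t^-)$ for $t\in\mathbb T_\sigma$. Its propagator $U_\sigma(t,s)$, $t\ge s\ge0$, is: $U_\sigma(t,s)=S(t-s)$ if $(s,t]\cap\mathbb T_\sigma=\varnothing$; otherwise, if $t_l<\dots<t_m$ are the impulse times in $(s,t]$, $U_\sigma(t,s)=S(t-t_m)JS(t_m-t_{m-1})J\cdots JS(t_l-s)$. $\kappa_\sigma(t,s):=\#(\mathbb T_\sigma\cap(s,t])$. Strong UGES over a family $\mathcal S$: there exist $M\ge1$, $\alpha>0$, $\rho\in(0,1)$ such that $\|U_\sigma(t,s)\|\le M\rho^{\kappa_\sigma(t,s)}e^{-\alpha(t-s)}$ for all $t\ge s\ge0$ and all $\sigma\in\mathcal S$. Growth condition for $\mathcal S_{\min}(T_{\min})$: there exist a piecewise continuous $g:\mathbb R_{\ge0}\to\mathbb R_{>0}$ bounded below by some $c_0>0$, and $\mu>1$, such that $\|U_\sigma(t,s)x\|\le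 g(t-s)\mu^{\kappa_\sigma(t,s)}\|x\|$ for all $t\ge s\ge0$, $x\in H$, $\sigma\in\mathcal S_{\min}(T_{\min})$, and $\sup_{\tau\ge0}g(\tau)<\infty$. Notation: $P\succeq Q$ (resp. $P\succ Q$) means $\langle h,(P-Q)h\rangle_H\ge0$ for all $h\in H$ (resp. $>0$ for all $h\ne0$). Expressions $\langle d,(A^*P+PA)d\rangle_H$ with $d\in D(A)$ are understood as the quadratic form $\langle Ad,Pd\rangle_H+\langle Pd,Ad\rangle_H$. Strongly differentiable: $\tau\mapsto\bar P(\tau)h$ is differentiable for every $h\in H$, with derivative $\dot{\bar P}(\tau)h$. *)

theory Defs
  imports "HOL-Analysis.Analysis"
begin

(* Hilbert spaces are types of class {real_inner, complete_space}.  A complex Hilbert space is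
   covered by restriction of scalars with the inner product Re <x,y>: operator norms, adjoints,
   self-adjointness, generators and the real quadratic forms used below are unchanged.
   The bounded operators L(H) are the type of bounded linear functions. *)

definition C0_semigroup :: "(real \<Rightarrow> 'a::real_normed_vector \<Rightarrow>\<^sub>L 'a) \<Rightarrow> bool" where
  "C0_semigroup S \<longleftrightarrow>
     S 0 = id_blinfun \<and>
     (\<forall>s\<ge>0. \<forall>t\<ge>0. S (s + t) = S s o\<^sub>L S t) \<and>
     (\<forall>x. ((\<lambda>t. blinfun_apply (S t) x) \<longlongrightarrow> x) (at_right 0))"

(* An unbounded operator is a function A together with its domain D;
   the values of A outside D are irrelevant. *)
definition generates_C0_semigroup ::
    "('a::real_normed_vector \<Rightarrow> 'a) \<Rightarrow> 'a set \<Rightarrow> (real \<Rightarrow> 'a \<Rightarrow>\<^sub>L 'a) \<Rightarrow> bool" where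
  "generates_C0_semigroup A D S \<longleftrightarrow>
     C0_semigroup S \<and>
     D = {x. \<exists>y. ((\<lambda>t. (blinfun_apply (S t) x - x) /\<^sub>R t) \<longlongrightarrow> y) (at_right 0)} \<and>
     (\<forall>x\<in>D. ((\<lambda>t. (blinfun_apply (S t) x - x) /\<^sub>R t) \<longlongrightarrow> A x) (at_right 0))"

(* The impulse times are \<sigma> 1, \<sigma> 2, ...; the entry \<sigma> 0 = 0 is the convention t_0 = 0
   and is not an impulse time. *)
definition impulse_sequences :: "(nat \<Rightarrow> real) set" where
  "impulse_sequences =
     {\<sigma>. \<sigma> 0 = 0 \<and> (\<forall>k. \<sigma> k < \<sigma> (Suc k)) \<and> filterlim \<sigma> at_top sequentially}"

definition impulse_times :: "(nat \<Rightarrow> real) \<Rightarrow> real set" where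
  "impulse_times \<sigma> = \<sigma> ` {1..}"

definition S_min :: "real \<Rightarrow> (nat \<Rightarrow> real) set" where
  "S_min Tmin = {\<sigma>\<in>impulse_sequences. \<forall>k. \<sigma> (Suc k) - \<sigma> k \<ge> Tmin}"

definition impulse_count :: "(nat \<Rightarrow> real) \<Rightarrow> real \<Rightarrow> real \<Rightarrow> nat" where
  "impulse_count \<sigma> t s = card (impulse_times \<sigma> \<inter> {s<..t})"

(* For an increasing list [t_l, ..., t_m] of times in (s,t] this is
   S(t - t_m) J S(t_m - t_(m-1)) J ... J S(t_l - s). *)
fun impulse_product ::
    "(real \<Rightarrow> 'a::real_normed_vector \<Rightarrow>\<^sub>L 'a) \<Rightarrow> 'a \<Rightarrow>\<^sub>L 'a \<Rightarrow> real list \<Rightarrow> real \<Rightarrow> real \<Rightarrow> 'a \<Rightarrow>\<^sub>L 'a" where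
  "impulse_product S J [] t s = S (t - s)"
| "impulse_product S J (r # rs) t s = impulse_product S J rs t r o\<^sub>L J o\<^sub>L S (r - s)"

(* The set below is finite for \<sigma> in impulse_sequences, since the impulse times tend to infinity. *)
definition propagator ::
    "(real \<Rightarrow> 'a::real_normed_vector \<Rightarrow>\<^sub>L 'a) \<Rightarrow> 'a \<Rightarrow>\<^sub>L 'a \<Rightarrow> (nat \<Rightarrow> real) \<Rightarrow> real \<Rightarrow> real \<Rightarrow> 'a \<Rightarrow>\<^sub>L 'a" where
  "propagator S J \<sigma> t s =
     impulse_product S J (sorted_list_of_set (impulse_times \<sigma> \<inter> {s<..t})) t s"

definition strongly_UGES ::
    "(real \<Rightarrow> 'a::real_normed_vector \<Rightarrow>\<^sub>L 'a) \<Rightarrow> 'a \<Rightarrow>\<^sub>L 'a \<Rightarrow> (nat \<Rightarrow> real) set \<Rightarrow> bool" where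
  "strongly_UGES S J \<S> \<longleftrightarrow>
     (\<exists>M \<alpha> \<rho>. M \<ge> 1 \<and> \<alpha> > 0 \<and> 0 < \<rho> \<and> \<rho> < 1 \<and>
        (\<forall>\<sigma>\<in>\<S>. \<forall>t s. 0 \<le> s \<and> s \<le> t \<longrightarrow>
           norm (propagator S J \<sigma> t s) \<le> M * \<rho> ^ impulse_count \<sigma> t s * exp (- \<alpha> * (t - s))))"

(* Finitely many discontinuities on every bounded interval, and finite one-sided limits everywhere. *)
definition piecewise_continuous_nonneg :: "(real \<Rightarrow> real) \<Rightarrow> bool" where
  "piecewise_continuous_nonneg g \<longleftrightarrow>
     (\<forall>b. finite {\<tau>\<in>{0..b}. \<not> continuous (at \<tau> within {0..}) g}) \<and>
     (\<forall>\<tau>\<ge>0. \<exists>l. (g \<longlongrightarrow> l) (at_right \<tau>)) \<and>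
     (\<forall>\<tau>>0. \<exists>l. (g \<longlongrightarrow> l) (at_left \<tau>))"

definition growth_condition ::
    "(real \<Rightarrow> 'a::real_normed_vector \<Rightarrow>\<^sub>L 'a) \<Rightarrow> 'a \<Rightarrow>\<^sub>L 'a \<Rightarrow> (nat \<Rightarrow> real) set \<Rightarrow> bool" where
  "growth_condition S J \<S> \<longleftrightarrow>
     (\<exists>g c\<^sub>0 \<mu>. piecewise_continuous_nonneg g \<and>
        c\<^sub>0 > 0 \<and> (\<forall>\<tau>\<ge>0. g \<tau> \<ge> c\<^sub>0) \<and> bdd_above (g ` {0..}) \<and> \<mu> > 1 \<and>
        (\<forall>\<sigma>\<in>\<S>. \<forall>t s x. 0 \<le> s \<and> s \<le> t \<longrightarrow>
           norm (blinfun_apply (propagator S J \<sigma> t s) x)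
             \<le> g (t - s) * \<mu> ^ impulse_count \<sigma> t s * norm x))"

definition self_adjoint :: "('a::real_inner \<Rightarrow>\<^sub>L 'a) \<Rightarrow> bool" where
  "self_adjoint P \<longleftrightarrow> (\<forall>x y. blinfun_apply P x \<bullet> y = x \<bullet> blinfun_apply P y)"

definition op_ge :: "('a::real_inner \<Rightarrow>\<^sub>L 'a) \<Rightarrow> ('a \<Rightarrow>\<^sub>L 'a) \<Rightarrow> bool" (infix "\<succeq>" 50) where
  "P \<succeq> Q \<longleftrightarrow> (\<forall>h. h \<bullet> blinfun_apply (P - Q) h \<ge> 0)"

definition op_gt :: "('a::real_inner \<Rightarrow>\<^sub>L 'a) \<Rightarrow> ('a \<Rightarrow>\<^sub>L 'a) \<Rightarrow> bool" (infix "\<succ>" 50) where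
  "P \<succ> Q \<longleftrightarrow> (\<forall>h. h \<noteq> 0 \<longrightarrow> h \<bullet> blinfun_apply (P - Q) h > 0)"

(* The meaning of <d, (A^* P + P A) d> for d in the domain of A. *)
definition lyapunov_form :: "('a::real_inner \<Rightarrow> 'a) \<Rightarrow> ('a \<Rightarrow>\<^sub>L 'a) \<Rightarrow> 'a \<Rightarrow> real" where
  "lyapunov_form A P d = A d \<bullet> blinfun_apply P d + blinfun_apply P d \<bullet> A d"

end

theory Submission
  imports Defs
begin

text \<open>
  The proof is a Lyapunov argument followed by one of Datko type. Let \<open>\<tau>\<close> be the time since the last
  impulse, saturated at \<open>Tmin\<close>, and consider \<open>x \<bullet> P \<tau> x\<close> along a trajectory \<open>x\<close>. Between impulses and
  for data in the domain of the generator, the differential equation for \<open>P\<close> (while the clock runs) and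
  the inequality at \<open>Tmin\<close> (once it has stopped) make this functional decrease at a rate at least
  \<open>\<alpha> * (norm x)\<^sup>2\<close>, where \<open>\<alpha> > 0\<close> is the smaller of the coercivity constants of \<open>Q\<close> and
  \<open>Qinf\<close>. By the dwell-time condition every impulse finds the clock stopped, and the jump equation
  shows that the functional does not increase there.

  The functional need not be coercive, so its decrease does not bound the state directly. Instead, if
  \<open>K\<close> bounds the evolution from all times in \<open>{s..t}\<close> to \<open>t\<close>, then all intermediate states have norm at
  least \<open>norm (x t) / K\<close>, and the energy balance yields
  \<open>\<alpha> * (t - s) * (norm (x t))\<^sup>2 \<le> K\<^sup>2 * c * (norm (x s))\<^sup>2\<close> with \<open>c\<close> the upper bound of \<open>P\<close>
  (lemmas \<open>dissipation_on_domain\<close> and \<open>dissipation\<close>). Combined with the growth condition, this bounds the propagators uniformly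
  (\<open>uniform_bound\<close>); a second application makes them contractions by \<open>1 / 2\<close> over intervals of a fixed
  length, which is exponential decay (\<open>exponential_decay\<close>). As the number of impulses grows at most
  linearly in time, part of the decay rate can be traded for a factor \<open>\<rho> ^ \<kappa>\<close>.

  The analytic ingredients are proved for real Hilbert spaces of arbitrary dimension: the Riesz
  representation, from which come the adjoint of \<open>J\<close> and weak integrals; density of the domain of the
  generator; and differentiability of \<open>x \<bullet> P x\<close> when \<open>P\<close> is only strongly differentiable, which rests
  on the bound of \<open>norm (P x)\<close> by the quadratic form.
\<close>

section \<open>Hilbert space tools\<close>

text \<open>
  The representing vector is the minimiser of the functional
  \<open>\<phi> x = x \<bullet> x / 2 - f x\<close>: it is bounded below, the parallelogram identity makes every minimising
  sequence Cauchy, and the first-order condition at the minimiser is the claim.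
\<close>

lemma riesz_representation_real:
  fixes f :: "'a::{real_inner, complete_space} \<Rightarrow> real"
  assumes "bounded_linear f"
  obtains z where "\<And>x. f x = z \<bullet> x"
proof -
  interpret f: bounded_linear f by fact
  define \<phi> where "\<phi> x = x \<bullet> x / 2 - f x" for x
  obtain C where C: "\<And>x. norm (f x) \<le> norm x * C" "C > 0"
    using f.pos_bounded by blast
  (* completing the square in norm x *)
  have lower: "- C\<^sup>2 / 2 \<le> \<phi> x" for x
  proof -
    have "f x \<le> norm x * C" using C(1)[of x] by simp
    moreover have "0 \<le> (norm x - C)\<^sup>2" by simp
    ultimately show ?thesis
      by (simp add: \<phi>_def power2_diff flip: power2_norm_eq_inner)
  qed
  define m where "m = Inf (range \<phi>)"
  have bdd: "bdd_below (range \<phi>)" using lower by (auto intro!: bdd_belowI)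
  have m_le: "m \<le> \<phi> x" for x unfolding m_def by (rule cInf_lower) (auto simp: bdd)
  have "\<exists>x. \<phi> x < m + 1 / real (Suc n)" for n
  proof -
    have "m < m + 1 / real (Suc n)" by simp
    then show ?thesis unfolding m_def by (subst (asm) cInf_less_iff) (auto simp: bdd)
  qed
  then obtain u where u: "\<And>n. \<phi> (u n) < m + 1 / real (Suc n)" by metis
  have dist_le: "(norm (x - y))\<^sup>2 \<le> 4 * (\<phi> x - m) + 4 * (\<phi> y - m)" for x y
  proof -
    have "\<phi> ((1/2) *\<^sub>R (x + y)) = (\<phi> x + \<phi> y) / 2 - (norm (x - y))\<^sup>2 / 8"
      by (simp add: \<phi>_def f.scaleR f.add power2_norm_eq_inner inner_simps inner_commute field_simps)
    with m_le[of "(1/2) *\<^sub>R (x + y)"]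
    have "m \<le> (\<phi> x + \<phi> y) / 2 - (norm (x - y))\<^sup>2 / 8" by simp
    then show ?thesis by (simp add: field_simps)
  qed
  have phi_lim: "(\<lambda>n. \<phi> (u n)) \<longlonglongrightarrow> m"
  proof (rule tendsto_sandwich[of "\<lambda>_. m" _ _ "\<lambda>n. m + 1 / real (Suc n)"])
    show "(\<lambda>n. m + 1 / real (Suc n)) \<longlonglongrightarrow> m"
      using tendsto_add[OF tendsto_const LIMSEQ_inverse_real_of_nat, of m] by (simp add: field_simps)
  qed (use m_le u in \<open>auto intro!: always_eventually less_imp_le\<close>)
  have "Cauchy u"
  proof (rule metric_CauchyI)
    fix e :: real assume "e > 0"
    then have "\<forall>\<^sub>F n in sequentially. \<phi> (u n) < m + e\<^sup>2 / 8"
      by (intro order_tendstoD(2)[OF phi_lim]) simp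
    then obtain N where N: "\<And>n. n \<ge> N \<Longrightarrow> \<phi> (u n) < m + e\<^sup>2 / 8"
      by (auto simp: eventually_sequentially)
    have "dist (u i) (u j) < e" if "i \<ge> N" "j \<ge> N" for i j
    proof -
      have "(norm (u i - u j))\<^sup>2 < e\<^sup>2"
        using dist_le[of "u i" "u j"] N[OF that(1)] N[OF that(2)] by (simp add: algebra_simps)
      then show ?thesis using \<open>e > 0\<close> by (simp add: dist_norm power2_less_imp_less)
    qed
    then show "\<exists>N. \<forall>i\<ge>N. \<forall>j\<ge>N. dist (u i) (u j) < e" by blast
  qed
  then obtain z where z: "u \<longlonglongrightarrow> z" using Cauchy_convergent convergent_def by blast
  have "(\<lambda>n. \<phi> (u n)) \<longlonglongrightarrow> \<phi> z"
    unfolding \<phi>_def by (intro tendsto_intros z f.tendsto) auto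
  with phi_lim have phi_z: "\<phi> z = m" by (rule LIMSEQ_unique[rotated])
  have "f x = z \<bullet> x" for x
  proof (rule ccontr)
    define a where "a = z \<bullet> x - f x"
    assume "f x \<noteq> z \<bullet> x"
    then have a: "a \<noteq> 0" and x: "x \<bullet> x > 0" by (auto simp: a_def f.zero)
    (* the minimiser of the parabola t \<mapsto> \<phi> (z + t *\<^sub>R x) *)
    define t where "t = - a / (x \<bullet> x)"
    have tx: "t * (x \<bullet> x) = - a" using x by (simp add: t_def)
    have "(z + t *\<^sub>R x) \<bullet> (z + t *\<^sub>R x) = z \<bullet> z + 2 * t * (z \<bullet> x) + t * (t * (x \<bullet> x))"
      by (simp add: inner_add_left inner_add_right inner_commute[of x z] distrib_left)
    then have "\<phi> (z + t *\<^sub>R x) = \<phi> z + t * a + t * (t * (x \<bullet> x)) / 2"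
      by (simp add: \<phi>_def a_def f.add f.scaleR add_divide_distrib right_diff_distrib)
    also have "\<dots> = \<phi> z + t * a / 2" by (simp add: tx)
    also have "\<dots> < \<phi> z"
    proof -
      have "t * a = - (a\<^sup>2 / (x \<bullet> x))" by (simp add: t_def power2_eq_square)
      also have "\<dots> < 0" using a x by simp
      finally show ?thesis by simp
    qed
    finally show False using m_le[of "z + t *\<^sub>R x"] phi_z by simp
  qed
  then show ?thesis by (rule that)
qed

text \<open>
  The constant \<^const>\<open>adjoint\<close> is a choice operator, which has its defining property only where an
  adjoint exists; outside Euclidean spaces this is what the Riesz representation provides.
\<close>

lemma adjoint_works_hilbert:
  fixes T :: "'a::{real_inner, complete_space} \<Rightarrow> 'b::real_inner"
  assumes "bounded_linear T"
  shows "T x \<bullet> y = x \<bullet> adjoint T y"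
proof -
  have "\<exists>w. \<forall>x. T x \<bullet> y = x \<bullet> w" for y
  proof -
    have "bounded_linear (\<lambda>x. T x \<bullet> y)"
      using bounded_linear_compose[OF bounded_linear_inner_left assms] .
    then obtain w where "\<And>x. T x \<bullet> y = w \<bullet> x" by (rule riesz_representation_real) blast
    then show ?thesis by (metis inner_commute)
  qed
  then have "\<exists>T'. \<forall>x y. T x \<bullet> y = x \<bullet> T' y" by metis
  then have "\<forall>x y. T x \<bullet> y = x \<bullet> adjoint T y"
    unfolding adjoint_def by (rule someI_ex)
  then show ?thesis by blast
qed

text \<open>
  The class of \<open>'a\<close> does not entail \<^class>\<open>banach\<close>, so vector-valued integrals of continuous functions
  are obtained weakly: the Riesz vector of the functional that integrates the scalar products.
\<close>

lemma weak_integral_exists: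
  fixes u :: "real \<Rightarrow> 'a::{real_inner, complete_space}"
  assumes u: "continuous_on {a..b} u"
  obtains I where "\<And>z. I \<bullet> z = integral {a..b} (\<lambda>r. u r \<bullet> z)"
proof -
  have int: "(\<lambda>r. u r \<bullet> z) integrable_on {a..b}" for z
    by (intro integrable_continuous_real continuous_intros u)
  have "compact (u ` {a..b})" by (rule compact_continuous_image[OF u]) simp
  then obtain B where B: "\<And>r. r \<in> {a..b} \<Longrightarrow> norm (u r) \<le> B"
    by (meson bounded_iff compact_imp_bounded image_eqI)
  have "bounded_linear (\<lambda>z. integral {a..b} (\<lambda>r. u r \<bullet> z))"
  proof (rule bounded_linear_intro)
    fix x
    show "norm (integral {a..b} (\<lambda>r. u r \<bullet> x)) \<le> norm x * (B * measure lborel (cbox a b))"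
    proof (cases "a \<le> b")
      case True
      have "B \<ge> 0" using order_trans[OF norm_ge_zero B[of a]] True by simp
      moreover have "norm (u r \<bullet> x) \<le> B * norm x" if "r \<in> {a..b}" for r
        using Cauchy_Schwarz_ineq2[of "u r" x] mult_right_mono[OF B[OF that] norm_ge_zero[of x]] by simp
      ultimately show ?thesis
        using has_integral_bound[of "B * norm x" "\<lambda>r. u r \<bullet> x" _ a b] integrable_integral[OF int]
        by (simp add: mult_ac)
    qed simp
  qed (simp_all add: inner_add_right integral_add[OF int int])
  then obtain I where "\<And>z. integral {a..b} (\<lambda>r. u r \<bullet> z) = I \<bullet> z"
    by (rule riesz_representation_real) blast
  then have "\<And>z. I \<bullet> z = integral {a..b} (\<lambda>r. u r \<bullet> z)" by simp
  then show ?thesis by (rule that)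
qed

text \<open>
  Cauchy-Schwarz for the positive form of \<open>P\<close>, applied to \<open>x\<close> and \<open>y = P x\<close>, turns a bound on the
  quadratic form into a bound on the operator norm.
\<close>

lemma self_adjoint_form_bound:
  fixes P :: "'a::real_inner \<Rightarrow>\<^sub>L 'a"
  assumes sa: "self_adjoint P" and pos: "P \<succ> 0" and le: "c *\<^sub>R id_blinfun \<succeq> P" and "c \<ge> 0"
  shows "norm (blinfun_apply P x) \<le> c * norm x"
proof -
  have nonneg: "0 \<le> h \<bullet> P h" for h
    using pos by (cases "h = 0") (auto simp: op_gt_def less_imp_le)
  have upper: "h \<bullet> P h \<le> c * (norm h)\<^sup>2" for h
    using le by (simp add: op_ge_def blinfun.bilinear_simps inner_simps power2_norm_eq_inner)
  define y where "y = P x"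
  define a where "a = x \<bullet> P x"
  define b where "b = y \<bullet> P y"
  have xy: "x \<bullet> P y = y \<bullet> y"
    using sa by (simp add: self_adjoint_def y_def)
  (* the form at t x - P x; its discriminant gives Cauchy-Schwarz *)
  have q: "0 \<le> a * t\<^sup>2 - 2 * t * (y \<bullet> y) + b" for t
    using nonneg[of "t *\<^sub>R x - y"] sa xy
    by (simp add: a_def b_def blinfun.bilinear_simps inner_simps power2_eq_square self_adjoint_def
        y_def inner_commute algebra_simps)
  have CS: "(y \<bullet> y)\<^sup>2 \<le> a * b"
  proof (cases "a = 0")
    case True
    have "y \<bullet> y = 0"
    proof (rule ccontr)
      assume "y \<bullet> y \<noteq> 0"
      then have "y \<bullet> y > 0" by simp
      then show False
        using q[of "(b + 1) / (2 * (y \<bullet> y))"] True by (simp add: field_simps)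
    qed
    then show ?thesis using True by simp
  next
    case False
    then have "a > 0" using nonneg[of x] by (simp add: a_def)
    then show ?thesis using q[of "(y \<bullet> y) / a"] by (simp add: power2_eq_square field_simps)
  qed
  have "(norm y)\<^sup>2 * (norm y)\<^sup>2 \<le> (c * (norm x)\<^sup>2) * (c * (norm y)\<^sup>2)"
    using order_trans[OF CS[unfolded a_def b_def] mult_mono[OF upper[of x] upper[of y]]] nonneg \<open>c \<ge> 0\<close>
    by (simp add: power2_norm_eq_inner power2_eq_square[of "y \<bullet> y"])
  then have "(norm y)\<^sup>2 * (norm y)\<^sup>2 \<le> (c * norm x)\<^sup>2 * (norm y)\<^sup>2"
    by (simp add: power2_eq_square mult_ac)
  then have "y = 0 \<or> (norm y)\<^sup>2 \<le> (c * norm x)\<^sup>2"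
    by (subst (asm) mult_le_cancel_right) auto
  then have "norm y \<le> c * norm x"
  proof
    assume "(norm y)\<^sup>2 \<le> (c * norm x)\<^sup>2"
    then show ?thesis by (rule power2_le_imp_le) (simp add: \<open>c \<ge> 0\<close>)
  qed (simp add: \<open>c \<ge> 0\<close>)
  then show ?thesis by (simp add: y_def)
qed

lemma has_vector_derivative_iff_quotient:
  fixes f :: "real \<Rightarrow> 'a::real_normed_vector"
  shows "(f has_vector_derivative f') (at x within T) \<longleftrightarrow>
    ((\<lambda>y. (f y - f x) /\<^sub>R (y - x)) \<longlongrightarrow> f') (at x within T)"
proof -
  have "(f has_vector_derivative f') (at x within T) \<longleftrightarrow>
      ((\<lambda>y. norm ((f y - f x - (y - x) *\<^sub>R f') /\<^sub>R norm (y - x))) \<longlongrightarrow> 0) (at x within T)"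
    unfolding has_vector_derivative_def has_derivative_at_within tendsto_norm_zero_iff
    by (simp add: bounded_linear_scaleR_left)
  also have "\<dots> \<longleftrightarrow> ((\<lambda>y. norm ((f y - f x) /\<^sub>R (y - x) - f')) \<longlongrightarrow> 0) (at x within T)"
  proof (rule filterlim_cong[OF refl refl])
    have "norm ((f y - f x - (y - x) *\<^sub>R f') /\<^sub>R norm (y - x))
          = norm ((f y - f x) /\<^sub>R (y - x) - f')" if "y \<noteq> x" for y
    proof -
      have "(f y - f x) /\<^sub>R (y - x) - f' = (f y - f x - (y - x) *\<^sub>R f') /\<^sub>R (y - x)"
        using that by (simp add: scaleR_diff_right)
      then show ?thesis by simp
    qed
    then show "\<forall>\<^sub>F y in at x within T. norm ((f y - f x - (y - x) *\<^sub>R f') /\<^sub>R norm (y - x))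
          = norm ((f y - f x) /\<^sub>R (y - x) - f')"
      by (auto simp: eventually_at_filter)
  qed
  also have "\<dots> \<longleftrightarrow> ((\<lambda>y. (f y - f x) /\<^sub>R (y - x)) \<longlongrightarrow> f') (at x within T)"
    by (simp only: tendsto_norm_zero_iff LIM_zero_iff)
  finally show ?thesis .
qed

text \<open>
  A product rule under strong differentiability of \<open>P\<close> only. By self-adjointness the increment is
  \<open>(x s - x r) \<bullet> P s (x s + x r) + x r \<bullet> (P s - P r) (x r)\<close>, in which \<open>P s - P r\<close> acts on the fixed
  vector \<open>x r\<close>.
\<close>

lemma quadratic_form_has_derivative:
  fixes P :: "real \<Rightarrow> 'a::real_inner \<Rightarrow>\<^sub>L 'a"
  assumes x: "(x has_vector_derivative x') (at r within T)"
    and P: "((\<lambda>s. P s (x r)) has_vector_derivative p') (at r within T)"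
    and sa: "\<And>s. s \<in> T \<Longrightarrow> self_adjoint (P s)"
    and bd: "\<And>s h. s \<in> T \<Longrightarrow> norm (P s h) \<le> c * norm h"
  shows "((\<lambda>s. x s \<bullet> P s (x s)) has_real_derivative (x r \<bullet> p' + 2 * (x' \<bullet> P r (x r)))) (at r within T)"
proof -
  let ?F = "at r within T"
  have inT: "\<forall>\<^sub>F s in ?F. s \<in> T \<and> s \<noteq> r" by (auto simp: eventually_at_filter)
  have xr: "(x \<longlongrightarrow> x r) ?F"
    using has_vector_derivative_continuous[OF x] by (simp add: continuous_within)
  have Pr: "((\<lambda>s. P s (x r)) \<longlongrightarrow> P r (x r)) ?F"
    using has_vector_derivative_continuous[OF P] by (simp add: continuous_within)
  (* no continuity of P in operator norm is available, so the uniform bound c makes this term vanish *)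
  have "((\<lambda>s. P s (x s - x r)) \<longlongrightarrow> 0) ?F"
  proof (rule Lim_null_comparison)
    show "\<forall>\<^sub>F s in ?F. norm (P s (x s - x r)) \<le> c * norm (x s - x r)"
      using inT by eventually_elim (auto intro: bd)
    show "((\<lambda>s. c * norm (x s - x r)) \<longlongrightarrow> 0) ?F"
      using tendsto_mult_right_zero[OF tendsto_norm_zero[OF LIM_zero[OF xr]]] .
  qed
  from tendsto_add[OF this tendsto_scaleR[OF tendsto_const[of 2] Pr]]
  have "((\<lambda>s. P s (x s + x r)) \<longlongrightarrow> 2 *\<^sub>R P r (x r)) ?F"
    by (simp add: blinfun.bilinear_simps scaleR_2)
  moreover have "((\<lambda>s. (x s - x r) /\<^sub>R (s - r)) \<longlongrightarrow> x') ?F"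
    using x by (simp add: has_vector_derivative_iff_quotient)
  moreover have "((\<lambda>s. (P s (x r) - P r (x r)) /\<^sub>R (s - r)) \<longlongrightarrow> p') ?F"
    using P by (simp add: has_vector_derivative_iff_quotient)
  ultimately have lim: "((\<lambda>s. ((x s - x r) /\<^sub>R (s - r)) \<bullet> P s (x s + x r)
      + x r \<bullet> ((P s (x r) - P r (x r)) /\<^sub>R (s - r))) \<longlongrightarrow> x' \<bullet> (2 *\<^sub>R P r (x r)) + x r \<bullet> p') ?F"
    by (intro tendsto_intros)
  have "((\<lambda>s. (x s \<bullet> P s (x s) - x r \<bullet> P r (x r)) / (s - r)) \<longlongrightarrow> x' \<bullet> (2 *\<^sub>R P r (x r)) + x r \<bullet> p') ?F"
  proof (rule Lim_transform_eventually[OF lim])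
    show "\<forall>\<^sub>F s in ?F. ((x s - x r) /\<^sub>R (s - r)) \<bullet> P s (x s + x r)
      + x r \<bullet> ((P s (x r) - P r (x r)) /\<^sub>R (s - r)) = (x s \<bullet> P s (x s) - x r \<bullet> P r (x r)) / (s - r)"
      using inT
    proof eventually_elim
      case (elim s)
      then have "x r \<bullet> P s (x s) = x s \<bullet> P s (x r)"
        using sa[of s] by (simp add: self_adjoint_def inner_commute)
      then show ?case
        by (simp add: blinfun.bilinear_simps inner_simps divide_inverse algebra_simps)
    qed
  qed
  then show ?thesis
    by (simp add: has_field_derivative_iff add.commute)
qed

section \<open>Orbits and domain of a bounded semigroup\<close>

locale bounded_C0_semigroup =
  fixes A :: "'a::{real_inner, complete_space} \<Rightarrow> 'a" and D :: "'a set"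
    and S :: "real \<Rightarrow> 'a \<Rightarrow>\<^sub>L 'a" and G :: real
  assumes generator: "generates_C0_semigroup A D S"
    and bound: "t \<ge> 0 \<Longrightarrow> norm (S t x) \<le> G * norm x"
    and G_nonneg: "G \<ge> 0"
begin

lemma S_0 [simp]: "S 0 = id_blinfun"
  and S_add: "s \<ge> 0 \<Longrightarrow> t \<ge> 0 \<Longrightarrow> S (s + t) = S s o\<^sub>L S t"
  and S_strong: "((\<lambda>t. S t x) \<longlongrightarrow> x) (at_right 0)"
  using generator by (auto simp: generates_C0_semigroup_def C0_semigroup_def)

lemma S_add_apply: "s \<ge> 0 \<Longrightarrow> t \<ge> 0 \<Longrightarrow> S (s + t) x = S s (S t x)"
  by (simp add: S_add)

lemma D_iff: "x \<in> D \<longleftrightarrow> (\<exists>y. ((\<lambda>t. (S t x - x) /\<^sub>R t) \<longlongrightarrow> y) (at_right 0))"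
  using generator unfolding generates_C0_semigroup_def by blast

lemma A_tendsto: "x \<in> D \<Longrightarrow> ((\<lambda>t. (S t x - x) /\<^sub>R t) \<longlongrightarrow> A x) (at_right 0)"
  using generator unfolding generates_C0_semigroup_def by blast

lemma A_eqI:
  assumes "((\<lambda>t. (S t x - x) /\<^sub>R t) \<longlongrightarrow> y) (at_right 0)"
  shows "x \<in> D" "A x = y"
proof -
  show "x \<in> D" using assms D_iff by blast
  from tendsto_unique[OF _ A_tendsto[OF this] assms] show "A x = y" by simp
qed

text \<open>
  Continuity at every time follows from continuity at time zero: pull the smaller of the two times
  out of the difference and use the uniform bound.
\<close>

lemma S_diff_le:
  assumes "s \<ge> 0" "t \<ge> 0"
  shows "norm (S t x - S s x) \<le> G * norm (S \<bar>t - s\<bar> x - x)"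
proof -
  have le: "norm (S t x - S s x) \<le> G * norm (S (t - s) x - x)" if "0 \<le> s" "s \<le> t" for s t
  proof -
    have "S t x - S s x = S s (S (t - s) x - x)"
      using S_add_apply[of s "t - s" x] that by (simp add: blinfun.diff_right)
    then show ?thesis using bound[OF that(1)] by simp
  qed
  show ?thesis
  proof (cases "s \<le> t")
    case True then show ?thesis using le assms by simp
  next
    case False then show ?thesis using le[of t s] assms by (simp add: norm_minus_commute)
  qed
qed

lemma S_continuous: "continuous_on {0..} (\<lambda>t. S t x)"
proof -
  have "((\<lambda>t. S t x) \<longlongrightarrow> S s x) (at s within {0..})" if "s \<ge> 0" for s
  proof -
    have "((\<lambda>r. norm (S r x - x)) \<longlongrightarrow> 0) (at_right 0)"
      using tendsto_norm_zero[OF LIM_zero[OF S_strong]] .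
    moreover have "filterlim (\<lambda>t. \<bar>t - s\<bar>) (at_right 0) (at s within {0..})"
      unfolding filterlim_at
      by (auto simp: eventually_at_filter intro!: tendsto_eq_intros)
    ultimately have "((\<lambda>t. G * norm (S \<bar>t - s\<bar> x - x)) \<longlongrightarrow> 0) (at s within {0..})"
      by (intro tendsto_mult_right_zero) (rule filterlim_compose)
    then have "((\<lambda>t. S t x - S s x) \<longlongrightarrow> 0) (at s within {0..})"
      by (rule Lim_null_comparison[rotated]) (use S_diff_le that in \<open>auto simp: eventually_at_filter\<close>)
    then show ?thesis by (rule LIM_zero_cancel)
  qed
  then show ?thesis by (simp add: continuous_on_def)
qed

lemma S_in_D:
  assumes "d \<in> D" "t \<ge> 0"
  shows "S t d \<in> D" "A (S t d) = S t (A d)"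
proof -
  have "((\<lambda>h. S t ((S h d - d) /\<^sub>R h)) \<longlongrightarrow> S t (A d)) (at_right 0)"
    by (intro tendsto_intros A_tendsto assms)
  moreover have "\<forall>\<^sub>F h in at_right 0. S t ((S h d - d) /\<^sub>R h) = (S h (S t d) - S t d) /\<^sub>R h"
    unfolding eventually_at_filter
  proof (intro always_eventually allI impI)
    fix h :: real assume "h \<in> {0<..}"
    then show "S t ((S h d - d) /\<^sub>R h) = (S h (S t d) - S t d) /\<^sub>R h"
      using S_add_apply[of t h d] S_add_apply[of h t d] assms(2)
      by (simp add: blinfun.bilinear_simps add.commute)
  qed
  ultimately have "((\<lambda>h. (S h (S t d) - S t d) /\<^sub>R h) \<longlongrightarrow> S t (A d)) (at_right 0)"
    by (rule Lim_transform_eventually)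
  from A_eqI[OF this] show "S t d \<in> D" "A (S t d) = S t (A d)" .
qed

text \<open>
  From either side the difference quotient at \<open>t\<close> is \<open>S (min r t)\<close> applied to the quotient at zero
  for the time \<open>\<bar>r - t\<bar>\<close>, so the bound on the semigroup and strong continuity give both one-sided
  derivatives at once.
\<close>

lemma orbit_has_vector_derivative:
  assumes d: "d \<in> D" and t: "t \<ge> 0"
  shows "((\<lambda>r. S r d) has_vector_derivative A (S t d)) (at t within {0..})"
proof -
  define q where "q h = (S h d - d) /\<^sub>R h" for h
  let ?F = "at t within {0..}"
  have nz: "\<forall>\<^sub>F r in ?F. r \<ge> 0 \<and> r \<noteq> t" by (auto simp: eventually_at_filter)
  have q_lim: "((\<lambda>r. q \<bar>r - t\<bar>) \<longlongrightarrow> A d) ?F"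
  proof (rule filterlim_compose[of q])
    show "(q \<longlongrightarrow> A d) (at_right 0)" unfolding q_def by (rule A_tendsto[OF d])
    show "filterlim (\<lambda>r. \<bar>r - t\<bar>) (at_right 0) ?F"
      unfolding filterlim_at by (auto simp: eventually_at_filter intro!: tendsto_eq_intros)
  qed
  have quot: "(S r d - S t d) /\<^sub>R (r - t) = S (min r t) (q \<bar>r - t\<bar>)" if "r \<ge> 0 \<and> r \<noteq> t" for r
  proof (cases "r < t")
    case True
    then have "S t d = S r (S (t - r) d)" using S_add_apply[of r "t - r" d] that by simp
    moreover have "(S r d - S t d) /\<^sub>R (r - t) = (S t d - S r d) /\<^sub>R (t - r)"
    proof -
      have "inverse (r - t) = - inverse (t - r)" by (metis inverse_minus_eq minus_diff_eq)
      then show ?thesis by (simp add: scaleR_diff_right)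
    qed
    ultimately show ?thesis using True by (simp add: q_def blinfun.bilinear_simps)
  next
    case False
    then have "S r d = S t (S (r - t) d)" using S_add_apply[of t "r - t" d] t by simp
    then show ?thesis using False that by (simp add: q_def blinfun.bilinear_simps)
  qed
  have "((\<lambda>r. S (min r t) (q \<bar>r - t\<bar> - A d)) \<longlongrightarrow> 0) ?F"
  proof (rule Lim_null_comparison)
    show "\<forall>\<^sub>F r in ?F. norm (S (min r t) (q \<bar>r - t\<bar> - A d)) \<le> G * norm (q \<bar>r - t\<bar> - A d)"
      using nz by eventually_elim (use t in \<open>auto intro: bound\<close>)
    show "((\<lambda>r. G * norm (q \<bar>r - t\<bar> - A d)) \<longlongrightarrow> 0) ?F"
      by (intro tendsto_mult_right_zero tendsto_norm_zero LIM_zero q_lim)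
  qed
  moreover have "((\<lambda>r. S (min r t) (A d)) \<longlongrightarrow> S t (A d)) ?F"
  proof -
    have "continuous_on {0..} (\<lambda>r. S (min r t) (A d))"
      by (rule continuous_on_compose2[OF S_continuous]) (use t in \<open>auto intro!: continuous_intros\<close>)
    then have "((\<lambda>r. S (min r t) (A d)) \<longlongrightarrow> S (min t t) (A d)) ?F"
      using t unfolding continuous_on_def by blast
    then show ?thesis by simp
  qed
  ultimately have "((\<lambda>r. S (min r t) (q \<bar>r - t\<bar> - A d) + S (min r t) (A d)) \<longlongrightarrow> 0 + S t (A d)) ?F"
    by (rule tendsto_add)
  then have "((\<lambda>r. S (min r t) (q \<bar>r - t\<bar>)) \<longlongrightarrow> A (S t d)) ?F"
    by (simp add: blinfun.bilinear_simps S_in_D d t)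
  then have "((\<lambda>r. (S r d - S t d) /\<^sub>R (r - t)) \<longlongrightarrow> A (S t d)) ?F"
    by (rule Lim_transform_eventually) (use nz quot in \<open>auto elim!: eventually_mono\<close>)
  then show ?thesis by (simp add: has_vector_derivative_iff_quotient)
qed

text \<open>
  With \<open>I t\<close> the integral of the orbit of \<open>x\<close> over \<open>[0, t]\<close>, the averages \<open>I t / t\<close> tend to \<open>x\<close>. The
  two ways of splitting \<open>I (t + h)\<close> give \<open>S t (I h) - I h = S h (I t) - I t\<close>; dividing by \<open>t\<close> shows
  that \<open>I h\<close>, and with it \<open>I h / h\<close>, lies in the domain.
\<close>

lemma domain_dense: "closure D = UNIV"
proof -
  have "x \<in> closure D" for x
  proof -
    have S_int: "(\<lambda>r. S r x \<bullet> z) integrable_on {a..b}" if "a \<ge> 0" for a b z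
      by (intro integrable_continuous_real continuous_intros continuous_on_subset[OF S_continuous])
         (use that in auto)
    have "\<exists>w. \<forall>z. w \<bullet> z = integral {0..t} (\<lambda>r. S r x \<bullet> z)" for t
      by (rule weak_integral_exists[OF continuous_on_subset[OF S_continuous[of x], of "{0..t}"]]) auto
    then obtain I where I: "\<And>t z. I t \<bullet> z = integral {0..t} (\<lambda>r. S r x \<bullet> z)" by metis
    have I_add: "I (s + t) = I s + S s (I t)" if "s \<ge> 0" "t \<ge> 0" for s t
    proof -
      have "I (s + t) \<bullet> z = (I s + S s (I t)) \<bullet> z" for z
      proof -
        have adj: "S s w \<bullet> z = w \<bullet> adjoint (S s) z" for w
          by (rule adjoint_works_hilbert) (rule blinfun.bounded_linear_right)
        have "S s (I t) \<bullet> z = integral {0..t} (\<lambda>r. S s (S r x) \<bullet> z)"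
          by (simp only: adj I)
        also have "\<dots> = integral {0..t} (\<lambda>r. S (r + s) x \<bullet> z)"
          by (rule integral_cong) (use that in \<open>simp add: S_add_apply add.commute[of _ s]\<close>)
        also have "\<dots> = integral {s..s + t} (\<lambda>r. S r x \<bullet> z)"
          using integral_shift_real_ivl[of s s "s + t" "\<lambda>r. S r x \<bullet> z"] by simp
        finally have "S s (I t) \<bullet> z = integral {s..s + t} (\<lambda>r. S r x \<bullet> z)" .
        moreover have "integral {0..s} (\<lambda>r. S r x \<bullet> z) + integral {s..s + t} (\<lambda>r. S r x \<bullet> z)
            = integral {0..s + t} (\<lambda>r. S r x \<bullet> z)"
          by (rule Henstock_Kurzweil_Integration.integral_combine[OF _ _ S_int]) (use that in auto)
        ultimately show ?thesis by (simp add: I inner_add_left)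
      qed
      then show ?thesis using vector_eq_rdot by blast
    qed
    have I_lim: "((\<lambda>t. I t /\<^sub>R t) \<longlongrightarrow> x) (at_right 0)"
    proof (rule tendstoI)
      fix e :: real assume "e > 0"
      then have "\<forall>\<^sub>F t in at_right 0. dist (S t x) x < e / 2"
        by (intro tendstoD[OF S_strong]) simp
      then obtain b where b: "b > 0" "\<And>r. 0 < r \<Longrightarrow> r < b \<Longrightarrow> dist (S r x) x < e / 2"
        by (auto simp: eventually_at_right_field)
      have "dist (I t /\<^sub>R t) x < e" if t: "0 < t" "t < b" for t
      proof -
        define z where "z = I t - t *\<^sub>R x"
        have le: "norm ((S r x - x) \<bullet> z) \<le> e / 2 * norm z" if "r \<in> {0..t}" for r
        proof -
          have "norm (S r x - x) \<le> e / 2"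
            using b(2)[of r] that t \<open>e > 0\<close> by (cases "r = 0") (auto simp: dist_norm)
          then show ?thesis
            using Cauchy_Schwarz_ineq2[of "S r x - x" z] mult_right_mono[OF _ norm_ge_zero[of z]]
            by (metis real_norm_def order_trans)
        qed
        have "((\<lambda>r. S r x \<bullet> z - x \<bullet> z) has_integral (I t \<bullet> z - t * (x \<bullet> z))) {0..t}"
          using has_integral_diff[OF integrable_integral[OF S_int[of 0 z t]] has_integral_const_real[of "x \<bullet> z" 0 t]] t
          by (simp add: I)
        then have "((\<lambda>r. (S r x - x) \<bullet> z) has_integral (z \<bullet> z)) (cbox 0 t)"
          by (simp add: inner_diff_left z_def)
        from has_integral_bound[OF _ this, of "e / 2 * norm z"] le \<open>e > 0\<close> t
        have "norm z * norm z \<le> e / 2 * t * norm z"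
          by (simp add: power2_norm_eq_inner[symmetric] power2_eq_square mult_ac)
        then have "norm z \<le> e / 2 * t"
          by (subst (asm) mult_le_cancel_right) (use \<open>e > 0\<close> t in auto)
        moreover have "I t /\<^sub>R t - x = z /\<^sub>R t" using t by (simp add: z_def scaleR_diff_right)
        then have "dist (I t /\<^sub>R t) x = norm z / t"
          using t by (simp add: dist_norm divide_inverse mult.commute)
        ultimately have "dist (I t /\<^sub>R t) x \<le> e / 2"
          using t by (simp add: divide_le_eq)
        then show ?thesis using \<open>e > 0\<close> by simp
      qed
      then show "\<forall>\<^sub>F t in at_right 0. dist (I t /\<^sub>R t) x < e"
        using b(1) by (auto simp: eventually_at_right_field)
    qed
    have I_D: "I h /\<^sub>R h \<in> D" if h: "h > 0" for h
    proof (rule A_eqI(1))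
      have "((\<lambda>t. (S h (I t /\<^sub>R t) - I t /\<^sub>R t) /\<^sub>R h) \<longlongrightarrow> (S h x - x) /\<^sub>R h) (at_right 0)"
        by (intro tendsto_intros I_lim)
      moreover have "(S h (I t /\<^sub>R t) - I t /\<^sub>R t) /\<^sub>R h = (S t (I h /\<^sub>R h) - I h /\<^sub>R h) /\<^sub>R t"
        if "t > 0" for t
      proof -
        have "S h (I t) - I t = S t (I h) - I h"
          using I_add[of t h] I_add[of h t] h that by (simp add: add.commute algebra_simps)
        then show ?thesis
          by (simp add: blinfun.bilinear_simps scaleR_diff_right[symmetric] mult.commute)
      qed
      ultimately show "((\<lambda>t. (S t (I h /\<^sub>R h) - I h /\<^sub>R h) /\<^sub>R t) \<longlongrightarrow> (S h x - x) /\<^sub>R h) (at_right 0)"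
        by (elim Lim_transform_eventually) (auto simp: eventually_at_filter)
    qed
    show "x \<in> closure D"
      unfolding closure_approachable
    proof (intro allI impI)
      fix e :: real assume "e > 0"
      have "\<forall>\<^sub>F h in at_right 0. dist (I h /\<^sub>R h) x < e \<and> h > 0"
        using tendstoD[OF I_lim \<open>e > 0\<close>] by (auto simp: eventually_at_filter elim: eventually_mono)
      then show "\<exists>y\<in>D. dist y x < e"
        using eventually_happens'[OF trivial_limit_at_right_real] I_D by blast
    qed
  qed
  then show ?thesis by auto
qed

end

section \<open>The clock-dependent Lyapunov functional\<close>

lemma derivative_le_imp_decrease:
  fixes f :: "real \<Rightarrow> real"
  assumes "0 \<le> L"
    and f: "\<And>r. 0 \<le> r \<Longrightarrow> r \<le> L \<Longrightarrow> (f has_real_derivative f' r) (at r within {0..L})"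
    and le: "\<And>r. 0 < r \<Longrightarrow> r < L \<Longrightarrow> f' r \<le> - k"
  shows "f L \<le> f 0 - k * L"
proof -
  have "f L + k * L \<le> f 0 + k * 0"
  proof (rule DERIV_nonpos_imp_decreasing_open[OF \<open>0 \<le> L\<close>, of "\<lambda>r. f r + k * r"])
    fix r assume r: "0 < r" "r < L"
    then have "(f has_real_derivative f' r) (at r)"
      using f[of r] by (simp add: at_within_Icc_at)
    then have "((\<lambda>r. f r + k * r) has_real_derivative f' r + k) (at r)"
      by (auto intro!: derivative_eq_intros)
    then show "\<exists>y. ((\<lambda>r. f r + k * r) has_real_derivative y) (at r) \<and> y \<le> 0"
      using le[OF r] by (intro exI[of _ "f' r + k"]) simp
  next
    have "continuous_on {0..L} f"
      by (rule DERIV_continuous_on) (use f in auto)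
    then show "continuous_on {0..L} (\<lambda>r. f r + k * r)" by (intro continuous_intros)
  qed
  then show ?thesis by simp
qed

text \<open>
  What the operator equations contribute to the stability proof: decrease along the flow while the
  clock runs, decrease along the flow once the clock has stopped at \<open>Tmin\<close>, and no increase across an
  impulse that comes with a stopped clock.
\<close>

locale clock_dependent_lyapunov = bounded_C0_semigroup A D S G
  for A :: "'a::{real_inner, complete_space} \<Rightarrow> 'a" and D S G +
  fixes J :: "'a \<Rightarrow>\<^sub>L 'a" and Tmin :: real and P :: "real \<Rightarrow> 'a \<Rightarrow>\<^sub>L 'a" and P' :: "real \<Rightarrow> 'a \<Rightarrow> 'a"
    and c \<alpha> :: real
  assumes Tmin_pos: "Tmin > 0" and c_pos: "c > 0" and \<alpha>_pos: "\<alpha> > 0"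
    and J_D: "d \<in> D \<Longrightarrow> J d \<in> D"
    and P_self_adjoint: "\<tau> \<in> {0..Tmin} \<Longrightarrow> self_adjoint (P \<tau>)"
    and P_derivative: "\<tau> \<in> {0..Tmin} \<Longrightarrow> ((\<lambda>r. P r h) has_vector_derivative P' \<tau> h) (at \<tau> within {0..Tmin})"
    and P_pos: "\<tau> \<in> {0..Tmin} \<Longrightarrow> P \<tau> \<succ> 0"
    and P_le: "\<tau> \<in> {0..Tmin} \<Longrightarrow> c *\<^sub>R id_blinfun \<succeq> P \<tau>"
    and decay: "\<tau> \<in> {0<..<Tmin} \<Longrightarrow> d \<in> D \<Longrightarrow> d \<bullet> P' \<tau> d + lyapunov_form A (P \<tau>) d \<le> - \<alpha> * (norm d)\<^sup>2"
    and decay_saturated: "d \<in> D \<Longrightarrow> lyapunov_form A (P Tmin) d \<le> - \<alpha> * (norm d)\<^sup>2"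
    and jump: "J h \<bullet> P 0 (J h) \<le> h \<bullet> P Tmin h"
begin

text \<open>
  The clock is the time since the last impulse, saturated at \<open>Tmin\<close>.
\<close>

definition V :: "real \<Rightarrow> 'a \<Rightarrow> real" where
  "V \<tau> x = x \<bullet> P (min \<tau> Tmin) x"

lemma V_nonneg: "\<tau> \<ge> 0 \<Longrightarrow> V \<tau> x \<ge> 0"
  using P_pos[of "min \<tau> Tmin"] Tmin_pos
  by (cases "x = 0") (auto simp: V_def op_gt_def less_imp_le)

lemma V_le: "\<tau> \<ge> 0 \<Longrightarrow> V \<tau> x \<le> c * (norm x)\<^sup>2"
  using P_le[of "min \<tau> Tmin"] Tmin_pos
  by (simp add: V_def op_ge_def blinfun.bilinear_simps inner_simps power2_norm_eq_inner)

lemma P_norm_le: "\<tau> \<in> {0..Tmin} \<Longrightarrow> norm (P \<tau> h) \<le> c * norm h"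
  using self_adjoint_form_bound[OF P_self_adjoint P_pos P_le] c_pos by simp

lemma lyapunov_form_eq: "lyapunov_form A Q d = 2 * (A d \<bullet> Q d)"
  by (simp add: lyapunov_form_def inner_commute)

text \<open>
  Assuming a lower bound \<open>m\<close> on the orbit replaces the integral of \<open>(norm (S r d))\<^sup>2\<close> in the energy
  balance by \<open>m\<^sup>2 * L\<close>, so that the mean value theorem suffices.
\<close>

lemma flow_before_saturation:
  assumes d: "d \<in> D" and "0 \<le> \<tau>" "0 \<le> L" "\<tau> + L \<le> Tmin" "0 \<le> m"
    and m: "\<And>r. 0 < r \<Longrightarrow> r < L \<Longrightarrow> m \<le> norm (S r d)"
  shows "S L d \<bullet> P (\<tau> + L) (S L d) \<le> d \<bullet> P \<tau> d - \<alpha> * m\<^sup>2 * L"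
proof -
  define f where "f r = S r d \<bullet> P (\<tau> + r) (S r d)" for r
  define f' where "f' r = S r d \<bullet> P' (\<tau> + r) (S r d) + 2 * (A (S r d) \<bullet> P (\<tau> + r) (S r d))" for r
  have "f L \<le> f 0 - (\<alpha> * m\<^sup>2) * L"
  proof (rule derivative_le_imp_decrease[of L f f'])
    fix r assume r: "0 \<le> r" "r \<le> L"
    let ?F = "at r within {0..L}"
    have x: "((\<lambda>r. S r d) has_vector_derivative A (S r d)) ?F"
      by (rule has_vector_derivative_within_subset[OF orbit_has_vector_derivative[OF d]]) (use r in auto)
    have p: "((\<lambda>s. P (\<tau> + s) h) has_vector_derivative P' (\<tau> + r) h) ?F" for h
    proof -
      have "((\<lambda>s. \<tau> + s) has_vector_derivative 1) ?F"
        by (auto intro!: derivative_eq_intros)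
      moreover have "((\<lambda>r. P r h) has_vector_derivative P' (\<tau> + r) h) (at (\<tau> + r) within (\<lambda>s. \<tau> + s) ` {0..L})"
        by (rule has_vector_derivative_within_subset[OF P_derivative]) (use assms r in auto)
      ultimately have "((\<lambda>r. P r h) \<circ> (\<lambda>s. \<tau> + s) has_vector_derivative 1 *\<^sub>R P' (\<tau> + r) h) ?F"
        by (rule vector_diff_chain_within)
      then show ?thesis by (simp add: o_def)
    qed
    show "(f has_real_derivative f' r) ?F"
      unfolding f_def f'_def
      by (rule quadratic_form_has_derivative[OF x p, where c = c])
         (use P_self_adjoint P_norm_le assms in auto)
  next
    fix r assume r: "0 < r" "r < L"
    then have "S r d \<in> D" using S_in_D(1)[OF d] by simp
    then have "f' r \<le> - \<alpha> * (norm (S r d))\<^sup>2"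
      using decay[of "\<tau> + r" "S r d"] r assms by (simp add: f'_def lyapunov_form_eq)
    moreover have "m\<^sup>2 \<le> (norm (S r d))\<^sup>2" using m[OF r] \<open>0 \<le> m\<close> by (rule power_mono)
    then have "\<alpha> * m\<^sup>2 \<le> \<alpha> * (norm (S r d))\<^sup>2" using \<alpha>_pos by simp
    ultimately show "f' r \<le> - (\<alpha> * m\<^sup>2)" by simp
  qed fact
  then show ?thesis by (simp add: f_def)
qed

lemma flow_after_saturation:
  assumes d: "d \<in> D" and "0 \<le> L" "0 \<le> m"
    and m: "\<And>r. 0 < r \<Longrightarrow> r < L \<Longrightarrow> m \<le> norm (S r d)"
  shows "S L d \<bullet> P Tmin (S L d) \<le> d \<bullet> P Tmin d - \<alpha> * m\<^sup>2 * L"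
proof -
  define f where "f r = S r d \<bullet> P Tmin (S r d)" for r
  define f' where "f' r = S r d \<bullet> 0 + 2 * (A (S r d) \<bullet> P Tmin (S r d))" for r
  have "f L \<le> f 0 - (\<alpha> * m\<^sup>2) * L"
  proof (rule derivative_le_imp_decrease[of L f f'])
    fix r assume r: "0 \<le> r" "r \<le> L"
    let ?F = "at r within {0..L}"
    have x: "((\<lambda>r. S r d) has_vector_derivative A (S r d)) ?F"
      by (rule has_vector_derivative_within_subset[OF orbit_has_vector_derivative[OF d]]) (use r in auto)
    show "(f has_real_derivative f' r) ?F"
      unfolding f_def f'_def
      by (rule quadratic_form_has_derivative[OF x has_vector_derivative_const, where c = c])
         (use P_self_adjoint P_norm_le Tmin_pos in auto)
  next
    fix r assume r: "0 < r" "r < L"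
    then have "S r d \<in> D" using S_in_D(1)[OF d] by simp
    then have "f' r \<le> - \<alpha> * (norm (S r d))\<^sup>2"
      using decay_saturated[of "S r d"] by (simp add: f'_def lyapunov_form_eq)
    moreover have "m\<^sup>2 \<le> (norm (S r d))\<^sup>2" using m[OF r] \<open>0 \<le> m\<close> by (rule power_mono)
    then have "\<alpha> * m\<^sup>2 \<le> \<alpha> * (norm (S r d))\<^sup>2" using \<alpha>_pos by simp
    ultimately show "f' r \<le> - (\<alpha> * m\<^sup>2)" by simp
  qed fact
  then show ?thesis by (simp add: f_def)
qed

text \<open>
  If the clock saturates during the flow, the interval is cut at the saturation time.
\<close>

lemma V_flow:
  assumes d: "d \<in> D" and "0 \<le> \<tau>" "0 \<le> L" "0 \<le> m"
    and m: "\<And>r. 0 < r \<Longrightarrow> r < L \<Longrightarrow> m \<le> norm (S r d)"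
  shows "V (\<tau> + L) (S L d) \<le> V \<tau> d - \<alpha> * m\<^sup>2 * L"
proof -
  consider "Tmin \<le> \<tau>" | "\<tau> + L \<le> Tmin" | "\<tau> < Tmin" "Tmin < \<tau> + L" by linarith
  then show ?thesis
  proof cases
    case 1
    then show ?thesis using flow_after_saturation[OF d _ _ m] assms by (simp add: V_def)
  next
    case 2
    then show ?thesis using flow_before_saturation[OF d _ _ _ _ m] assms by (simp add: V_def)
  next
    case 3
    define L1 where "L1 = Tmin - \<tau>"
    define L2 where "L2 = \<tau> + L - Tmin"
    have L: "L1 > 0" "L2 > 0" "L = L1 + L2" "\<tau> + L1 = Tmin" using 3 by (auto simp: L1_def L2_def)
    have SL: "S (r + L1) d = S r (S L1 d)" if "r \<ge> 0" for r
      using S_add_apply[of r L1 d] that L by simp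
    have "S L1 d \<bullet> P Tmin (S L1 d) \<le> d \<bullet> P \<tau> d - \<alpha> * m\<^sup>2 * L1"
      using flow_before_saturation[OF d, of \<tau> L1 m] m assms L by simp
    moreover have "S L2 (S L1 d) \<bullet> P Tmin (S L2 (S L1 d)) \<le> S L1 d \<bullet> P Tmin (S L1 d) - \<alpha> * m\<^sup>2 * L2"
    proof (rule flow_after_saturation)
      show "S L1 d \<in> D" using S_in_D(1)[OF d] L by simp
      show "m \<le> norm (S r (S L1 d))" if "0 < r" "r < L2" for r
        using m[of "r + L1"] SL[of r] that L by simp
    qed (use L assms in auto)
    moreover have "S L d = S L2 (S L1 d)" using SL[of L2] L by (simp add: add.commute)
    ultimately show ?thesis using 3 L by (simp add: V_def distrib_left)
  qed
qed

lemma V_jump: "Tmin \<le> \<tau> \<Longrightarrow> V 0 (J h) \<le> V \<tau> h"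
  using jump[of h] Tmin_pos by (simp add: V_def)

end

section \<open>Dissipation along impulsive trajectories\<close>

lemma (in bounded_C0_semigroup) impulse_product_start:
  assumes "s \<le> r" "r \<le> t" "\<And>q. q \<in> set rs \<Longrightarrow> r \<le> q"
  shows "impulse_product S J rs t s = impulse_product S J rs t r o\<^sub>L S (r - s)"
proof (cases rs)
  case Nil
  then show ?thesis using S_add[of "t - r" "r - s"] assms by simp
next
  case (Cons q qs)
  then have "S (q - s) = S (q - r) o\<^sub>L S (r - s)"
    using S_add[of "q - r" "r - s"] assms by simp
  then show ?thesis by (intro blinfun_eqI) (simp add: Cons)
qed

lemma (in bounded_C0_semigroup) impulse_product_append:
  assumes "sorted rs" "set rs \<subseteq> {s..r}" "\<And>q. q \<in> set qs \<Longrightarrow> r \<le> q" "s \<le> r" "r \<le> t"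
  shows "impulse_product S J (rs @ qs) t s = impulse_product S J qs t r o\<^sub>L impulse_product S J rs r s"
  using assms
proof (induction rs arbitrary: s)
  case Nil
  then show ?case using impulse_product_start[of s r t qs] by simp
next
  case (Cons a rs)
  have "impulse_product S J (rs @ qs) t a = impulse_product S J qs t r o\<^sub>L impulse_product S J rs r a"
    by (rule Cons.IH) (use Cons.prems in auto)
  then show ?case by (intro blinfun_eqI) simp
qed

context clock_dependent_lyapunov
begin

abbreviation spaced :: "real list \<Rightarrow> bool" where
  "spaced \<equiv> sorted_wrt (\<lambda>a b. a + Tmin \<le> b)"

text \<open>
  The functional decreases at least at rate \<open>\<alpha> * (norm (x r))\<^sup>2\<close> along the trajectory \<open>x\<close>, and a bound \<open>K\<close> on
  the evolution from every intermediate time \<open>r\<close> to \<open>t\<close> forces \<open>norm (x r) \<ge> norm (x t) / K\<close>. Hence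
  the total decrease is at least \<open>\<alpha> * (t - s) * (norm (x t) / K)\<^sup>2\<close>, while nonnegativity of the
  functional at time \<open>t\<close> bounds it by its initial value. The parameter \<open>p\<close> is the time at which the
  clock was last reset, so that \<open>s - p\<close> is the initial clock value. The induction processes one
  impulse at a time; the spacing hypothesis makes each impulse meet a saturated clock. Membership in
  the domain is preserved by the flow and by the jumps.
\<close>

lemma dissipation_on_domain:
  assumes "d \<in> D" "p \<le> s" "s \<le> t" "spaced (p # rs)" "set rs \<subseteq> {s<..t}" "K > 0"
    and "\<And>r. r \<in> {s..t} \<Longrightarrow> norm (impulse_product S J (filter (\<lambda>q. r < q) rs) t r) \<le> K"
  shows "\<alpha> * (t - s) * (norm (impulse_product S J rs t s d))\<^sup>2 \<le> K\<^sup>2 * V (s - p) d"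
  using assms
proof (induction rs arbitrary: p s d)
  case Nil
  define x where "x = S (t - s) d"
  have le: "norm x / K \<le> norm (S r d)" if r: "0 < r" "r < t - s" for r
  proof -
    have "norm (S (t - (s + r))) \<le> K" using Nil(7)[of "s + r"] r by simp
    moreover have "x = S (t - (s + r)) (S r d)"
      using S_add_apply[of "t - (s + r)" r d] r by (simp add: x_def)
    ultimately have "norm x \<le> K * norm (S r d)"
      using norm_blinfun[of "S (t - (s + r))" "S r d"] mult_right_mono[OF _ norm_ge_zero] order_trans by metis
    then show ?thesis using \<open>K > 0\<close> by (simp add: divide_le_eq mult.commute)
  qed
  have "0 \<le> V (s - p + (t - s)) x" using Nil.prems by (intro V_nonneg) simp
  also have "\<dots> \<le> V (s - p) d - \<alpha> * (norm x / K)\<^sup>2 * (t - s)"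
    unfolding x_def[symmetric] using V_flow[OF Nil(1), of "s - p" "t - s" "norm x / K"] le Nil.prems
    by (simp add: x_def)
  finally have "\<alpha> * (norm x)\<^sup>2 * (t - s) \<le> K\<^sup>2 * V (s - p) d"
    using \<open>K > 0\<close> by (simp add: power_divide field_simps)
  then show ?case by (simp add: x_def mult_ac)
next
  case (Cons r1 rs)
  have r1: "s < r1" "r1 \<le> t" "p + Tmin \<le> r1" using Cons.prems by auto
  define y where "y = S (r1 - s) d"
  define x where "x = impulse_product S J rs t r1 (J y)"
  have y_D: "y \<in> D" using S_in_D(1)[OF \<open>d \<in> D\<close>] r1 by (simp add: y_def)
  have later: "r1 < q" if "q \<in> set rs" for q using Cons.prems that Tmin_pos by fastforce
  have x: "x = impulse_product S J (r1 # rs) t s d" by (simp add: x_def y_def)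
  have le: "norm x / K \<le> norm (S r d)" if r: "0 < r" "r < r1 - s" for r
  proof -
    have "filter (\<lambda>q. s + r < q) (r1 # rs) = r1 # rs"
      using r later by (auto simp: filter_id_conv) (use later in fastforce)
    then have "norm (impulse_product S J (r1 # rs) t (s + r)) \<le> K"
      using Cons.prems(7)[of "s + r"] r r1 by simp
    moreover have "x = impulse_product S J (r1 # rs) t (s + r) (S r d)"
      unfolding x using impulse_product_start[of s "s + r" t "r1 # rs" J] r r1 later
      by fastforce
    ultimately have "norm x \<le> K * norm (S r d)"
      using norm_blinfun[of "impulse_product S J (r1 # rs) t (s + r)" "S r d"]
        mult_right_mono[OF _ norm_ge_zero] order_trans by metis
    then show ?thesis using \<open>K > 0\<close> by (simp add: divide_le_eq mult.commute)
  qed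
  have "\<alpha> * (t - r1) * (norm x)\<^sup>2 \<le> K\<^sup>2 * V (r1 - r1) (J y)"
    unfolding x_def
  proof (rule Cons.IH)
    show "norm (impulse_product S J (filter (\<lambda>q. r < q) rs) t r) \<le> K" if "r \<in> {r1..t}" for r
      using Cons.prems(7)[of r] that r1 by simp
  qed (use Cons.prems later y_D J_D in auto)
  also have "V (r1 - r1) (J y) \<le> V (r1 - p) y" using V_jump[of "r1 - p" y] r1 by simp
  also have "V (r1 - p) y \<le> V (s - p) d - \<alpha> * (norm x / K)\<^sup>2 * (r1 - s)"
    using V_flow[OF \<open>d \<in> D\<close>, of "s - p" "r1 - s" "norm x / K"] le Cons.prems r1
    by (simp add: y_def)
  finally have "\<alpha> * (t - r1) * (norm x)\<^sup>2 \<le> K\<^sup>2 * V (s - p) d - \<alpha> * (norm x)\<^sup>2 * (r1 - s)"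
    using \<open>K > 0\<close> by (simp add: power_divide right_diff_distrib)
  then have "\<alpha> * (t - s) * (norm x)\<^sup>2 \<le> K\<^sup>2 * V (s - p) d" by (simp add: algebra_simps)
  then show ?case by (simp add: x)
qed

text \<open>
  The inequality on the domain does not involve the generator and extends to all states by density.
\<close>

lemma dissipation:
  assumes "p \<le> s" "s \<le> t" "spaced (p # rs)" "set rs \<subseteq> {s<..t}" "K > 0"
    and "\<And>r. r \<in> {s..t} \<Longrightarrow> norm (impulse_product S J (filter (\<lambda>q. r < q) rs) t r) \<le> K"
  shows "\<alpha> / c * (t - s) * (norm (impulse_product S J rs t s))\<^sup>2 \<le> K\<^sup>2"
proof (cases "s = t")
  case False
  let ?U = "impulse_product S J rs t s"
  define b where "b = K / sqrt (\<alpha> / c * (t - s))"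
  have pos: "\<alpha> / c * (t - s) > 0" using False assms \<alpha>_pos c_pos by simp
  then have b: "b > 0" "b\<^sup>2 = K\<^sup>2 / (\<alpha> / c * (t - s))"
    using \<open>K > 0\<close> by (simp_all add: b_def power_divide)
  have on_D: "norm (?U d) \<le> b * norm d" if d: "d \<in> D" for d
  proof (rule power2_le_imp_le)
    have "\<alpha> * (t - s) * (norm (?U d))\<^sup>2 \<le> K\<^sup>2 * V (s - p) d"
      by (rule dissipation_on_domain) (use assms d in auto)
    also have "V (s - p) d \<le> c * (norm d)\<^sup>2" using V_le assms by simp
    finally have "\<alpha> * (t - s) * (norm (?U d))\<^sup>2 \<le> K\<^sup>2 * (c * (norm d)\<^sup>2)" using \<open>K > 0\<close> by simp
    then show "(norm (?U d))\<^sup>2 \<le> (b * norm d)\<^sup>2"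
      using pos \<alpha>_pos c_pos False assms by (simp add: power_mult_distrib b(2) field_simps)
  qed (use b in simp)
  have "closed {x. norm (?U x) \<le> b * norm x}"
    by (intro closed_Collect_le continuous_intros)
  with on_D have "closure D \<subseteq> {x. norm (?U x) \<le> b * norm x}" by (intro closure_minimal) auto
  then have "norm ?U \<le> b" using domain_dense b by (intro norm_blinfun_bound) auto
  then have "(norm ?U)\<^sup>2 \<le> K\<^sup>2 / (\<alpha> / c * (t - s))" using power_mono[of "norm ?U" b 2] b by simp
  from iffD1[OF pos_le_divide_eq[OF pos] this] show ?thesis by (simp only: mult.commute)
qed simp

end

section \<open>Exponential decay of dissipative evolutions\<close>

text \<open>
  The estimate \<open>dissipative\<close> replaces the square-integrability of the orbits in Datko's theorem; \<open>growth\<close>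
  is a crude a priori bound with a possibly positive exponent.
\<close>

locale dissipative_evolution =
  fixes U :: "real \<Rightarrow> real \<Rightarrow> 'a::real_normed_vector \<Rightarrow>\<^sub>L 'a" and C \<omega> \<beta> :: real
  assumes cocycle: "0 \<le> s \<Longrightarrow> s \<le> r \<Longrightarrow> r \<le> t \<Longrightarrow> U t s = U t r o\<^sub>L U r s"
    and growth: "0 \<le> s \<Longrightarrow> s \<le> t \<Longrightarrow> norm (U t s) \<le> C * exp (\<omega> * (t - s))"
    and dissipative: "0 \<le> s \<Longrightarrow> s \<le> t \<Longrightarrow> K > 0 \<Longrightarrow> (\<And>r. r \<in> {s..t} \<Longrightarrow> norm (U t r) \<le> K)
      \<Longrightarrow> \<beta> * (t - s) * (norm (U t s))\<^sup>2 \<le> K\<^sup>2"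
    and C_pos: "C > 0" and \<omega>_nonneg: "\<omega> \<ge> 0" and \<beta>_pos: "\<beta> > 0"
begin

text \<open>
  Let \<open>K\<close> be the supremum of \<open>norm (U t r)\<close> over \<open>r \<in> {s..t}\<close>, finite by the growth bound, and let \<open>r\<close>
  nearly attain it. The dissipation estimate on \<open>{r..t}\<close> with this very \<open>K\<close> bounds \<open>t - r\<close> by a
  constant that does not depend on \<open>K\<close>, and on such a short interval the growth bound controls
  \<open>norm (U t r)\<close>, hence \<open>K\<close>.
\<close>

lemma uniform_bound:
  assumes "0 \<le> s" "s \<le> t"
  shows "norm (U t s) \<le> 2 * C * exp (4 * \<omega> / \<beta>)"
proof -
  define K where "K = (SUP r\<in>{s..t}. norm (U t r))"
  have bdd: "bdd_above ((\<lambda>r. norm (U t r)) ` {s..t})"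
  proof (rule bdd_aboveI2)
    fix r assume r: "r \<in> {s..t}"
    then have "norm (U t r) \<le> C * exp (\<omega> * (t - r))" using growth assms by simp
    also have "\<dots> \<le> C * exp (\<omega> * (t - s))"
      using r C_pos \<omega>_nonneg by (simp add: mult_left_mono)
    finally show "norm (U t r) \<le> C * exp (\<omega> * (t - s))" .
  qed
  have le_K: "norm (U t r) \<le> K" if "r \<in> {s..t}" for r
    unfolding K_def by (rule cSUP_upper[OF that bdd])
  have "K \<ge> 0" using le_K[of s] assms order_trans[OF norm_ge_zero] by fastforce
  have "K \<le> 2 * C * exp (4 * \<omega> / \<beta>)"
  proof (cases "K = 0")
    case False
    with \<open>K \<ge> 0\<close> have "K > 0" by simp
    then have "K / 2 < (SUP r\<in>{s..t}. norm (U t r))" by (simp add: K_def[symmetric])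
    then obtain r where r: "r \<in> {s..t}" "K / 2 < norm (U t r)"
      using less_cSUP_iff[OF _ bdd, of "K / 2"] assms by fastforce
    have "t - r \<le> 4 / \<beta>"
    proof -
      have "\<beta> * (t - r) * (K / 2)\<^sup>2 \<le> \<beta> * (t - r) * (norm (U t r))\<^sup>2"
        using r \<open>K > 0\<close> \<beta>_pos by (intro mult_left_mono power_mono) auto
      also have "\<dots> \<le> K\<^sup>2"
        by (rule dissipative) (use r assms \<open>K > 0\<close> le_K in auto)
      finally have "\<beta> * (t - r) / 4 * K\<^sup>2 \<le> 1 * K\<^sup>2" by (simp add: power_divide)
      then have "\<beta> * (t - r) / 4 \<le> 1" by (rule mult_right_le_imp_le) (use \<open>K > 0\<close> in simp)
      then show ?thesis using \<beta>_pos by (simp add: field_simps)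
    qed
    then have "\<omega> * (t - r) \<le> \<omega> * (4 / \<beta>)" using \<omega>_nonneg by (rule mult_left_mono)
    then have "C * exp (\<omega> * (t - r)) \<le> C * exp (4 * \<omega> / \<beta>)" using C_pos by (simp add: mult.commute)
    then show ?thesis using growth[of r t] r assms by simp
  qed (use C_pos in simp)
  then show ?thesis using le_K[of s] assms by simp
qed

text \<open>
  With the uniform bound \<open>M\<close> in place of \<open>K\<close>, dissipation gives norm at most \<open>1 / 2\<close> over every
  interval of length \<open>4 * M\<^sup>2 / \<beta>\<close>; the cocycle property iterates this.
\<close>

lemma exponential_decay:
  defines "M \<equiv> 2 * C * exp (4 * \<omega> / \<beta>)"
  assumes "0 \<le> s" "s \<le> t"
  shows "norm (U t s) \<le> 2 * M * exp (- (ln 2 * \<beta> / (4 * M\<^sup>2)) * (t - s))"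
proof -
  have M: "M > 0" using C_pos by (simp add: M_def)
  have bound: "norm (U t s) \<le> M" if "0 \<le> s" "s \<le> t" for t s
    using uniform_bound[OF that] by (simp add: M_def)
  define L where "L = 4 * M\<^sup>2 / \<beta>"
  have L: "L > 0" using M \<beta>_pos by (simp add: L_def)
  have half: "norm (U (s + L) s) \<le> 1 / 2" if "0 \<le> s" for s
  proof (rule power2_le_imp_le)
    have "\<beta> * ((s + L) - s) * (norm (U (s + L) s))\<^sup>2 \<le> M\<^sup>2"
      by (rule dissipative) (use that L M bound in auto)
    then show "(norm (U (s + L) s))\<^sup>2 \<le> (1 / 2)\<^sup>2"
      using M \<beta>_pos by (simp add: L_def power2_eq_square)
  qed simp
  have iterate: "norm (U t s) \<le> M * (1 / 2) ^ n" if "0 \<le> s" "s + real n * L \<le> t" for n s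
    using that
  proof (induction n arbitrary: s)
    case 0
    then show ?case using bound by simp
  next
    case (Suc n)
    have step: "s + L + real n * L \<le> t" using Suc.prems by (simp add: distrib_right)
    have "0 \<le> real n * L" using L by simp
    then have "s + L \<le> t" using step by linarith
    then have "U t s = U t (s + L) o\<^sub>L U (s + L) s"
      using Suc.prems(1) L by (intro cocycle) auto
    then have "norm (U t s) \<le> norm (U t (s + L)) * norm (U (s + L) s)"
      by (simp add: norm_blinfun_compose)
    also have "\<dots> \<le> (M * (1 / 2) ^ n) * (1 / 2)"
      using Suc.IH[of "s + L"] half Suc.prems(1) step L M by (intro mult_mono) auto
    finally show ?case by simp
  qed
  define n where "n = nat \<lfloor>(t - s) / L\<rfloor>"
  have n: "real n \<le> (t - s) / L" "(t - s) / L - 1 \<le> real n"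
    using assms L by (auto simp: n_def intro: of_nat_floor)
  have "s + real n * L \<le> t" using n(1) L by (simp add: field_simps)
  then have "norm (U t s) \<le> M * (1 / 2) ^ n" by (rule iterate[OF \<open>0 \<le> s\<close>])
  also have "(1 / 2) ^ n = exp (- ln 2 * real n)"
  proof -
    have "exp (- ln 2) = (1 / 2 :: real)" by (simp add: exp_minus)
    then show ?thesis by (simp only: exp_of_nat2_mult)
  qed
  also have "exp (- ln 2 * real n) \<le> exp (ln 2 - ln 2 * ((t - s) / L))"
  proof -
    have "ln 2 * ((t - s) / L - 1) \<le> ln 2 * real n" using n(2) by (intro mult_left_mono) auto
    then show ?thesis by (simp add: right_diff_distrib)
  qed
  also have "exp (ln 2 - ln 2 * ((t - s) / L)) = 2 * exp (- (ln 2 * \<beta> / (4 * M\<^sup>2)) * (t - s))"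
  proof -
    have "ln 2 * ((t - s) / L) = ln 2 * \<beta> / (4 * M\<^sup>2) * (t - s)" by (simp add: L_def)
    moreover have "exp (ln 2 - y) = 2 * exp (- y)" for y :: real
      by (simp add: exp_diff exp_minus divide_inverse)
    ultimately show ?thesis by (simp only: mult_minus_left)
  qed
  finally show ?thesis using M by simp
qed

end

section \<open>Impulse sequences with a minimal dwell time\<close>

lemma impulse_sequences_strict_mono: "\<sigma> \<in> impulse_sequences \<Longrightarrow> strict_mono \<sigma>"
  by (simp add: impulse_sequences_def strict_mono_Suc_iff)

lemma finite_impulse_times:
  assumes "\<sigma> \<in> impulse_sequences"
  shows "finite (impulse_times \<sigma> \<inter> {s<..t})"
proof -
  have "\<forall>\<^sub>F k in sequentially. t < \<sigma> k"
    using assms by (auto simp: impulse_sequences_def filterlim_at_top_dense)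
  then obtain N where N: "\<And>k. k \<ge> N \<Longrightarrow> t < \<sigma> k" by (auto simp: eventually_sequentially)
  have "impulse_times \<sigma> \<inter> {s<..t} \<subseteq> \<sigma> ` {..<N}"
    using N by (force simp: impulse_times_def not_le[symmetric])
  then show ?thesis by (rule finite_subset) simp
qed

lemma S_min_gap:
  assumes "\<sigma> \<in> S_min Tmin" "m < n"
  shows "\<sigma> m + Tmin \<le> \<sigma> n"
proof -
  have "\<sigma> m + Tmin \<le> \<sigma> (Suc m)" using assms(1) by (auto simp: S_min_def algebra_simps)
  also have "\<sigma> (Suc m) \<le> \<sigma> n"
    using assms impulse_sequences_strict_mono strict_mono_less_eq by (fastforce simp: S_min_def)
  finally show ?thesis .
qed

definition impulses :: "(nat \<Rightarrow> real) \<Rightarrow> real \<Rightarrow> real \<Rightarrow> real list" where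
  "impulses \<sigma> s t = sorted_list_of_set (impulse_times \<sigma> \<inter> {s<..t})"

lemma sorted_impulses: "sorted_wrt (<) (impulses \<sigma> s t)"
  by (simp add: impulses_def)

lemma length_impulses: "length (impulses \<sigma> s t) = impulse_count \<sigma> t s"
  by (simp add: impulses_def impulse_count_def)

lemma spaced_length:
  fixes p t Tmin :: real
  assumes "sorted_wrt (\<lambda>a b. a + Tmin \<le> b) (p # rs)" "p \<le> t" "\<And>r. r \<in> set rs \<Longrightarrow> r \<le> t"
  shows "real (length rs) * Tmin \<le> t - p"
  using assms
proof (induction rs arbitrary: p)
  case (Cons r rs)
  have "real (length rs) * Tmin \<le> t - r" by (rule Cons.IH) (use Cons.prems in auto)
  then show ?case using Cons.prems(1) by (simp add: distrib_right)
qed simp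

locale dwell_time_sequence =
  fixes \<sigma> :: "nat \<Rightarrow> real" and Tmin :: real
  assumes \<sigma>: "\<sigma> \<in> S_min Tmin" and Tmin: "Tmin > 0"
begin

lemma in_impulse_sequences: "\<sigma> \<in> impulse_sequences"
  using \<sigma> by (simp add: S_min_def)

lemma set_impulses: "set (impulses \<sigma> s t) = impulse_times \<sigma> \<inter> {s<..t}"
  by (simp add: impulses_def finite_impulse_times[OF in_impulse_sequences])

lemma impulses_unique:
  assumes "sorted_wrt (<) xs" "set xs = impulse_times \<sigma> \<inter> {s<..t}"
  shows "impulses \<sigma> s t = xs"
  using strict_sorted_equal[OF assms(1) sorted_impulses] by (simp add: set_impulses assms(2))

lemma impulses_filter:
  assumes "s \<le> r"
  shows "filter (\<lambda>q. r < q) (impulses \<sigma> s t) = impulses \<sigma> r t"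
  by (rule impulses_unique[symmetric])
     (use assms in \<open>auto simp: set_impulses intro!: sorted_wrt_filter sorted_impulses\<close>)

lemma impulses_append:
  assumes "s \<le> r" "r \<le> t"
  shows "impulses \<sigma> s t = impulses \<sigma> s r @ impulses \<sigma> r t"
  by (rule impulses_unique) (use assms in \<open>auto simp: set_impulses sorted_wrt_append sorted_impulses\<close>)

lemma impulse_times_gap:
  assumes "a \<in> impulse_times \<sigma>" "b \<in> impulse_times \<sigma>" "a < b"
  shows "a + Tmin \<le> b"
proof -
  obtain m n where "a = \<sigma> m" "b = \<sigma> n" using assms by (auto simp: impulse_times_def)
  moreover have "m < n"
    using assms(3) strict_mono_less[OF impulse_sequences_strict_mono[OF in_impulse_sequences]]
    by (simp add: calculation)
  ultimately show ?thesis using S_min_gap[OF \<sigma>] by simp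
qed

lemma spaced_impulses: "sorted_wrt (\<lambda>a b. a + Tmin \<le> b) (impulses \<sigma> s t)"
  by (rule sorted_wrt_mono_rel[OF _ sorted_impulses]) (auto simp: set_impulses intro: impulse_times_gap)

text \<open>
  The time \<open>p\<close> is the last entry of the sequence up to \<open>s\<close>. If there has been no impulse yet it is the
  initial entry \<open>\<sigma> 0 = 0\<close>: the dwell-time condition also separates the first impulse from time zero,
  so the clock may be started there.
\<close>

lemma last_impulse_before:
  assumes "s \<ge> 0"
  obtains p where "p \<le> s" "\<And>t. sorted_wrt (\<lambda>a b. a + Tmin \<le> b) (p # impulses \<sigma> s t)"
proof -
  have "\<forall>\<^sub>F k in sequentially. s < \<sigma> k"
    using in_impulse_sequences by (auto simp: impulse_sequences_def filterlim_at_top_dense)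
  then have ex: "\<exists>k. s < \<sigma> k" by (auto simp: eventually_sequentially)
  define n where "n = (LEAST k. s < \<sigma> k)"
  have n: "s < \<sigma> n" unfolding n_def by (rule LeastI_ex[OF ex])
  have "\<sigma> 0 = 0" using in_impulse_sequences by (simp add: impulse_sequences_def)
  then have "n \<noteq> 0" using n assms by (intro notI) simp
  then obtain m where m: "n = Suc m" by (cases n) auto
  have le: "\<sigma> m \<le> s" using not_less_Least[of m "\<lambda>k. s < \<sigma> k"] m by (simp add: n_def)
  have "\<sigma> m + Tmin \<le> q" if "q \<in> set (impulses \<sigma> s t)" for q t
  proof -
    obtain k where k: "q = \<sigma> k" "s < q" using \<open>q \<in> set _\<close> by (auto simp: set_impulses impulse_times_def)
    then have "m < k"
      using le strict_mono_less[OF impulse_sequences_strict_mono[OF in_impulse_sequences], of m k] by simp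
    then show ?thesis using S_min_gap[OF \<sigma>] k by simp
  qed
  then show ?thesis using that[OF le] spaced_impulses by simp
qed

lemma impulse_count_le:
  assumes "s \<le> t"
  shows "real (impulse_count \<sigma> t s) \<le> (t - s) / Tmin + 1"
proof (cases "impulses \<sigma> s t")
  case Nil
  then show ?thesis using length_impulses[of \<sigma> s t] assms Tmin by simp
next
  case (Cons r rs)
  have mem: "q \<in> {s<..t}" if "q \<in> set (r # rs)" for q
    using set_impulses[of s t] that by (simp add: Cons)
  have "real (length rs) * Tmin \<le> t - r"
    using spaced_length[of Tmin r rs t] spaced_impulses[of s t] mem by (simp add: Cons)
  also have "\<dots> \<le> t - s" using mem[of r] by simp
  finally have "real (length rs) \<le> (t - s) / Tmin" using Tmin by (simp add: pos_le_divide_eq)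
  then show ?thesis using length_impulses[of \<sigma> s t] by (simp add: Cons)
qed

end

lemma propagator_eq: "propagator S J \<sigma> t s = impulse_product S J (impulses \<sigma> s t) t s"
  by (simp add: propagator_def impulses_def)

text \<open>
  An admissible sequence whose first impulse comes after \<open>t\<close> makes the propagator from \<open>0\<close> to \<open>t\<close>
  equal to \<open>S t\<close>; the growth condition without any factor \<open>\<mu>\<close> then bounds the semigroup.
\<close>

lemma growth_condition_imp_semigroup_bounded:
  assumes growth: "\<And>\<sigma> t s x. \<sigma> \<in> S_min Tmin \<Longrightarrow> 0 \<le> s \<Longrightarrow> s \<le> t \<Longrightarrow>
      norm (propagator S J \<sigma> t s x) \<le> G * \<mu> ^ impulse_count \<sigma> t s * norm x"
    and "Tmin > 0" "t \<ge> 0"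
  shows "norm (blinfun_apply (S t) x) \<le> G * norm x"
proof -
  define h where "h = max Tmin (t + 1)"
  define \<sigma> where "\<sigma> k = real k * h" for k
  have h: "h > t" "h \<ge> Tmin" "h > 0" using assms by (auto simp: h_def)
  have "filterlim \<sigma> at_top sequentially"
    unfolding \<sigma>_def using h(3) by (intro filterlim_at_top_mult_tendsto_pos[OF tendsto_const] filterlim_real_sequentially)
  then have \<sigma>: "\<sigma> \<in> S_min Tmin"
    using h by (simp add: S_min_def impulse_sequences_def \<sigma>_def algebra_simps)
  have none: "impulse_times \<sigma> \<inter> {0<..t} = {}"
  proof -
    have "h \<le> \<sigma> k" if "k \<ge> 1" for k using mult_right_mono[of 1 "real k" h] that h by (simp add: \<sigma>_def)
    then show ?thesis using h(1) by (fastforce simp: impulse_times_def)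
  qed
  have "propagator S J \<sigma> t 0 = S t" by (simp add: propagator_def none)
  moreover have "impulse_count \<sigma> t 0 = 0" by (simp add: impulse_count_def none)
  ultimately show ?thesis using growth[OF \<sigma>, of 0 t x] \<open>t \<ge> 0\<close> by simp
qed

section \<open>Uniform exponential stability\<close>

context clock_dependent_lyapunov
begin

lemma propagator_dissipative:
  assumes \<sigma>: "\<sigma> \<in> S_min Tmin"
    and bound: "\<And>s t. 0 \<le> s \<Longrightarrow> s \<le> t \<Longrightarrow> norm (propagator S J \<sigma> t s) \<le> C * exp (\<omega> * (t - s))"
    and "C > 0" "\<omega> \<ge> 0"
  shows "dissipative_evolution (propagator S J \<sigma>) C \<omega> (\<alpha> / c)"
proof
  interpret dwell_time_sequence \<sigma> Tmin using \<sigma> Tmin_pos by unfold_locales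
  fix s r t :: real assume *: "0 \<le> s" "s \<le> r" "r \<le> t"
  have "sorted (impulses \<sigma> s r)"
    using sorted_impulses by (rule strict_sorted_imp_sorted)
  moreover have "set (impulses \<sigma> s r) \<subseteq> {s..r}" by (auto simp: set_impulses)
  moreover have "\<And>q. q \<in> set (impulses \<sigma> r t) \<Longrightarrow> r \<le> q" by (auto simp: set_impulses)
  ultimately show "propagator S J \<sigma> t s = propagator S J \<sigma> t r o\<^sub>L propagator S J \<sigma> r s"
    using * unfolding propagator_eq impulses_append[OF *(2,3)] by (intro impulse_product_append)
next
  interpret dwell_time_sequence \<sigma> Tmin using \<sigma> Tmin_pos by unfold_locales
  fix s t K :: real
  assume *: "0 \<le> s" "s \<le> t" "K > 0" and K: "\<And>r. r \<in> {s..t} \<Longrightarrow> norm (propagator S J \<sigma> t r) \<le> K"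
  obtain p where p: "p \<le> s" "\<And>t. spaced (p # impulses \<sigma> s t)"
    using last_impulse_before[OF \<open>0 \<le> s\<close>] by blast
  show "\<alpha> / c * (t - s) * (norm (propagator S J \<sigma> t s))\<^sup>2 \<le> K\<^sup>2"
    unfolding propagator_eq
  proof (rule dissipation[OF p(1) \<open>s \<le> t\<close> p(2) _ \<open>K > 0\<close>])
    fix r assume r: "r \<in> {s..t}"
    then show "norm (impulse_product S J (filter (\<lambda>q. r < q) (impulses \<sigma> s t)) t r) \<le> K"
      using K[OF r] by (simp add: propagator_eq impulses_filter)
  qed (auto simp: set_impulses)
qed (use assms \<alpha>_pos c_pos in auto)

text \<open>
  Under a minimal dwell time the number of impulses is at most \<open>(t - s) / Tmin + 1\<close>. This turns
  \<open>\<mu> ^ \<kappa>\<close> into an exponential growth bound. In the other direction, half of the resulting exponential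
  decay rate pays for a factor \<open>\<rho> ^ \<kappa>\<close> with \<open>\<rho> < 1\<close>.
\<close>

lemma strongly_UGES_S_min:
  assumes growth: "\<And>\<sigma> t s x. \<sigma> \<in> S_min Tmin \<Longrightarrow> 0 \<le> s \<Longrightarrow> s \<le> t \<Longrightarrow>
      norm (propagator S J \<sigma> t s x) \<le> G * \<mu> ^ impulse_count \<sigma> t s * norm x"
    and "G > 0" "\<mu> \<ge> 1"
  shows "strongly_UGES S J (S_min Tmin)"
proof -
  define \<omega> where "\<omega> = ln \<mu> / Tmin"
  define C where "C = G * \<mu>"
  have C: "C > 0" "\<omega> \<ge> 0" using assms Tmin_pos by (auto simp: C_def \<omega>_def)
  have diss: "dissipative_evolution (propagator S J \<sigma>) C \<omega> (\<alpha> / c)" if \<sigma>: "\<sigma> \<in> S_min Tmin" for \<sigma>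
  proof (rule propagator_dissipative[OF \<sigma> _ C])
    fix s t :: real assume st: "0 \<le> s" "s \<le> t"
    have dwell: "dwell_time_sequence \<sigma> Tmin" using \<sigma> Tmin_pos by unfold_locales
    have "norm (propagator S J \<sigma> t s) \<le> G * \<mu> ^ impulse_count \<sigma> t s"
      using growth[OF \<sigma> st] assms by (intro norm_blinfun_bound) auto
    also have "\<mu> ^ impulse_count \<sigma> t s = exp (ln \<mu> * real (impulse_count \<sigma> t s))"
      using \<open>\<mu> \<ge> 1\<close> by (simp add: exp_of_nat2_mult)
    also have "\<dots> \<le> exp (ln \<mu> * ((t - s) / Tmin + 1))"
      using dwell_time_sequence.impulse_count_le[OF dwell st(2)] \<open>\<mu> \<ge> 1\<close> by (simp add: mult_left_mono)
    also have "\<dots> = \<mu> * exp (\<omega> * (t - s))"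
      using \<open>\<mu> \<ge> 1\<close> by (simp add: distrib_left exp_add \<omega>_def)
    finally show "norm (propagator S J \<sigma> t s) \<le> C * exp (\<omega> * (t - s))"
      using \<open>G > 0\<close> by (simp add: C_def)
  qed
  define N where "N = 2 * C * exp (4 * \<omega> / (\<alpha> / c))"
  define \<gamma> where "\<gamma> = ln 2 * (\<alpha> / c) / (4 * N\<^sup>2)"
  have N: "N > 0" using C by (simp add: N_def)
  then have \<gamma>: "\<gamma> > 0" using \<alpha>_pos c_pos by (simp add: \<gamma>_def)
  define \<rho> where "\<rho> = exp (- (\<gamma> / 2 * Tmin))"
  define M where "M = max 1 (2 * N * exp (\<gamma> / 2 * Tmin))"
  have \<rho>: "0 < \<rho>" "\<rho> < 1" using \<gamma> Tmin_pos by (auto simp: \<rho>_def)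
  have "norm (propagator S J \<sigma> t s) \<le> M * \<rho> ^ impulse_count \<sigma> t s * exp (- (\<gamma> / 2) * (t - s))"
    if \<sigma>: "\<sigma> \<in> S_min Tmin" and st: "0 \<le> s" "s \<le> t" for \<sigma> s t
  proof -
    let ?\<kappa> = "real (impulse_count \<sigma> t s)"
    have dwell: "dwell_time_sequence \<sigma> Tmin" using \<sigma> Tmin_pos by unfold_locales
    let ?e = "exp (- (\<gamma> / 2) * (t - s))"
    have e: "?e \<le> exp (\<gamma> / 2 * Tmin) * \<rho> ^ impulse_count \<sigma> t s"
    proof -
      have "?\<kappa> * Tmin \<le> (t - s) + Tmin"
        using dwell_time_sequence.impulse_count_le[OF dwell st(2)] Tmin_pos by (simp add: field_simps)
      then have "\<gamma> / 2 * (?\<kappa> * Tmin) \<le> \<gamma> / 2 * ((t - s) + Tmin)"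
        using \<gamma> by (intro mult_left_mono) auto
      then have "exp (- (\<gamma> / 2) * (t - s)) \<le> exp (\<gamma> / 2 * Tmin - \<gamma> / 2 * (?\<kappa> * Tmin))"
        by (simp only: exp_le_cancel_iff distrib_left)
      also have "\<dots> = exp (\<gamma> / 2 * Tmin) * \<rho> ^ impulse_count \<sigma> t s"
      proof -
        have "\<rho> ^ impulse_count \<sigma> t s = exp (?\<kappa> * - (\<gamma> / 2 * Tmin))"
          unfolding \<rho>_def by (rule exp_of_nat_mult[symmetric])
        also have "?\<kappa> * - (\<gamma> / 2 * Tmin) = - (\<gamma> / 2 * (?\<kappa> * Tmin))" by simp
        finally show ?thesis by (simp only: exp_add[symmetric] diff_conv_add_uminus)
      qed
      finally show ?thesis .
    qed
    have "norm (propagator S J \<sigma> t s) \<le> 2 * N * exp (- \<gamma> * (t - s))"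
      using dissipative_evolution.exponential_decay[OF diss[OF \<sigma>] st] by (simp add: N_def \<gamma>_def)
    also have "exp (- \<gamma> * (t - s)) = ?e * ?e"
      by (simp add: exp_add[symmetric] flip: distrib_right)
    also have "2 * N * (?e * ?e) \<le> 2 * N * (exp (\<gamma> / 2 * Tmin) * \<rho> ^ impulse_count \<sigma> t s * ?e)"
      using N e by (intro mult_left_mono mult_right_mono) auto
    also have "\<dots> = 2 * N * exp (\<gamma> / 2 * Tmin) * \<rho> ^ impulse_count \<sigma> t s * ?e"
      by (simp only: mult.assoc)
    also have "\<dots> \<le> M * \<rho> ^ impulse_count \<sigma> t s * exp (- (\<gamma> / 2) * (t - s))"
      using \<rho> by (intro mult_right_mono) (auto simp: M_def)
    finally show ?thesis .
  qed
  then show ?thesis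
    unfolding strongly_UGES_def using \<rho> \<gamma>
    by (intro exI[of _ M] exI[of _ "\<gamma> / 2"] exI[of _ \<rho>]) (auto simp: M_def)
qed

end

theorem theorem6p9:
  fixes A :: "'a::{real_inner, complete_space} \<Rightarrow> 'a"
    and D :: "'a set"
    and S :: "real \<Rightarrow> 'a \<Rightarrow>\<^sub>L 'a"
    and J :: "'a \<Rightarrow>\<^sub>L 'a"
    and Tmin :: real
    and P Q :: "real \<Rightarrow> 'a \<Rightarrow>\<^sub>L 'a"
    and P' :: "real \<Rightarrow> 'a \<Rightarrow> 'a"
    and Qinf R :: "'a \<Rightarrow>\<^sub>L 'a"
    and c\<^sub>P \<alpha>\<^sub>q \<alpha>_inf \<alpha>\<^sub>r :: real
  assumes "Tmin > 0"
    and "generates_C0_semigroup A D S"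
    and "J \<noteq> 0"
    and "blinfun_apply J ` D \<subseteq> D"
    and "growth_condition S J (S_min Tmin)"
    and "\<forall>\<tau>\<in>{0..Tmin}. self_adjoint (P \<tau>)"
    and "\<forall>\<tau>\<in>{0..Tmin}. \<forall>h.
           ((\<lambda>r. blinfun_apply (P r) h) has_vector_derivative P' \<tau> h) (at \<tau> within {0..Tmin})"
    and "c\<^sub>P > 0"
    and "\<forall>\<tau>\<in>{0..Tmin}. P \<tau> \<succ> 0 \<and> c\<^sub>P *\<^sub>R id_blinfun \<succeq> P \<tau>"
    and "\<alpha>\<^sub>q > 0"
    and "\<forall>\<tau>\<in>{0..Tmin}. self_adjoint (Q \<tau>) \<and> Q \<tau> \<succeq> \<alpha>\<^sub>q *\<^sub>R id_blinfun"
    and "\<alpha>_inf > 0"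
    and "self_adjoint Qinf" and "Qinf \<succeq> \<alpha>_inf *\<^sub>R id_blinfun"
    and "\<alpha>\<^sub>r > 0"
    and "self_adjoint R" and "R \<succeq> \<alpha>\<^sub>r *\<^sub>R id_blinfun"
    and "\<forall>\<tau>\<in>{0<..<Tmin}. \<forall>d\<in>D.
           d \<bullet> P' \<tau> d + lyapunov_form A (P \<tau>) d + d \<bullet> blinfun_apply (Q \<tau>) d = 0"
    and "\<forall>d\<in>D. lyapunov_form A (P Tmin) d + d \<bullet> blinfun_apply Qinf d \<le> 0"
    and "\<forall>h. adjoint (blinfun_apply J) (blinfun_apply (P 0) (blinfun_apply J h))
             - blinfun_apply (P Tmin) h + blinfun_apply R h = 0"
  shows "strongly_UGES S J (S_min Tmin)"
proof -
  note Tmin = assms(1) and growth_cond = assms(5) and Q = assms(11) and Qinf = assms(14)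
  note R = assms(17) and riccati = assms(18) and riccati_end = assms(19) and jump_eq = assms(20)
  obtain g c0 \<mu> where g: "c0 > 0" "\<forall>\<tau>\<ge>0. g \<tau> \<ge> c0" "bdd_above (g ` {0..})" "\<mu> > 1"
    and growth_g: "\<forall>\<sigma>\<in>S_min Tmin. \<forall>t s x. 0 \<le> s \<and> s \<le> t \<longrightarrow>
      norm (propagator S J \<sigma> t s x) \<le> g (t - s) * \<mu> ^ impulse_count \<sigma> t s * norm x"
    using growth_cond unfolding growth_condition_def by blast
  define G where "G = (SUP \<tau>\<in>{0..}. g \<tau>)"
  have g_le: "g \<tau> \<le> G" if "\<tau> \<ge> 0" for \<tau>
    unfolding G_def by (rule cSUP_upper) (use that g in auto)
  have G: "G > 0" using g(1) g(2)[rule_format, of 0] g_le[of 0] by simp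
  have growth: "norm (propagator S J \<sigma> t s x) \<le> G * \<mu> ^ impulse_count \<sigma> t s * norm x"
    if "\<sigma> \<in> S_min Tmin" "0 \<le> s" "s \<le> t" for \<sigma> t s x
  proof -
    have "g (t - s) * (\<mu> ^ impulse_count \<sigma> t s * norm x) \<le> G * (\<mu> ^ impulse_count \<sigma> t s * norm x)"
      using g_le[of "t - s"] that g(4) by (intro mult_right_mono) auto
    then show ?thesis using growth_g[rule_format, of \<sigma> s t x] that by (simp add: mult.assoc)
  qed
  define \<alpha> where "\<alpha> = min \<alpha>\<^sub>q \<alpha>_inf"
  have quad: "\<alpha> * (norm d)\<^sup>2 \<le> d \<bullet> B d" if "B \<succeq> a *\<^sub>R id_blinfun" "\<alpha> \<le> a" for B :: "'a \<Rightarrow>\<^sub>L 'a" and a d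
  proof -
    have "\<alpha> * (norm d)\<^sup>2 \<le> a * (norm d)\<^sup>2" using that(2) by (simp add: mult_right_mono)
    also have "\<dots> \<le> d \<bullet> B d"
      using that(1) by (simp add: op_ge_def blinfun.bilinear_simps inner_simps power2_norm_eq_inner)
    finally show ?thesis .
  qed
  interpret clock_dependent_lyapunov A D S G J Tmin P P' c\<^sub>P \<alpha>
  proof
    show "norm (S t x) \<le> G * norm x" if "t \<ge> 0" for t x
      using growth_condition_imp_semigroup_bounded[OF growth Tmin that] .
    show "d \<bullet> P' \<tau> d + lyapunov_form A (P \<tau>) d \<le> - \<alpha> * (norm d)\<^sup>2"
      if "\<tau> \<in> {0<..<Tmin}" "d \<in> D" for \<tau> d
    proof -
      have "d \<bullet> P' \<tau> d + lyapunov_form A (P \<tau>) d + d \<bullet> Q \<tau> d = 0" using riccati that by blast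
      moreover have "\<alpha> * (norm d)\<^sup>2 \<le> d \<bullet> Q \<tau> d"
        by (rule quad[of _ \<alpha>\<^sub>q]) (use Q that in \<open>auto simp: \<alpha>_def\<close>)
      ultimately show ?thesis by simp
    qed
    show "lyapunov_form A (P Tmin) d \<le> - \<alpha> * (norm d)\<^sup>2" if "d \<in> D" for d
    proof -
      have "lyapunov_form A (P Tmin) d + d \<bullet> Qinf d \<le> 0" using riccati_end that by blast
      moreover have "\<alpha> * (norm d)\<^sup>2 \<le> d \<bullet> Qinf d"
        by (rule quad[of _ \<alpha>_inf]) (use Qinf in \<open>auto simp: \<alpha>_def\<close>)
      ultimately show ?thesis by simp
    qed
    show "J h \<bullet> P 0 (J h) \<le> h \<bullet> P Tmin h" for h
    proof -
      have "J h \<bullet> P 0 (J h) = h \<bullet> adjoint J (P 0 (J h))"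
        by (rule adjoint_works_hilbert) (rule blinfun.bounded_linear_right)
      also have "adjoint J (P 0 (J h)) = P Tmin h - R h"
        using jump_eq[rule_format, of h] by (simp add: algebra_simps)
      finally have "J h \<bullet> P 0 (J h) = h \<bullet> P Tmin h - h \<bullet> R h" by (simp add: inner_diff_right)
      moreover have "0 \<le> h \<bullet> R h"
      proof -
        have "\<alpha>\<^sub>r * (norm h)\<^sup>2 \<le> h \<bullet> R h"
          using R by (simp add: op_ge_def blinfun.bilinear_simps inner_simps power2_norm_eq_inner)
        moreover have "0 \<le> \<alpha>\<^sub>r * (norm h)\<^sup>2" using \<open>\<alpha>\<^sub>r > 0\<close> by simp
        ultimately show ?thesis by linarith
      qed
      ultimately show ?thesis by simp
    qed
  qed (use assms G in \<open>auto simp: \<alpha>_def\<close>)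
  show ?thesis by (rule strongly_UGES_S_min[OF growth G]) (use g(4) in auto)
qed

end
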